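(* For any $n\ge1$, there is a poset isomorphism $W_n^{\mathrm{tree}}\simeq K_n^{\mathrm{tree}}$. There are also isomorphisms $W_{n,0}^{\mathrm{tree}}\simeq J_n\simeq W_{0,n}^{\mathrm{tree}}$, where $J_n$ is the $(n-1)$-dimensional multiplihedron. Here $K_n^{\mathrm{tree}}$ is the poset of stable rooted ribbon trees with $n$ leaves, and $W_n^{\mathrm{tree}}$, $W_{n,0}^{\mathrm{tree}}$, $W_{0,n}^{\mathrm{tree}}$ are the posets of stable tree-pairs of type $\mathbf n=(n)$ (with $r=1$), $\mathbf n=(n,0)$ and $\mathbf n=(0,n)$ (with $r=2$), respectively.
   Context: **Rooted ribbon trees and $K_r^{\mathrm{tree}}$.** A rooted ribbon tree (RRT) is a finite tree $T$ with a chosen root $\alpha_{\mathrm{root}}$, edges oriented toward the root, together with a linear order $<_\alpha$ on the set $\mathrm{in}(\alpha)$ of incoming neighbors of each vertex $\alpha$ (so $\mathrm{in}(\alpha)$ is a finite sequence). A vertex is interior if $\mathrm{in}(\alpha)\neq\emptyset$, otherwise a leaf. The leaves are numbered $\lambda_1,\lambda_2,\dots$ in the left-to-right order induced by the orders $<_\alpha$. $T$ is stable if every interior vertex has at least 2 incoming neighbors. $K_r^{\mathrm{tree}}$ is the set of isomorphism classes of stable RRTs with $r$ leaves ($K_1^{\mathrm{tree}}$ consists of the one-vertex tree). A move on a stable RRT: choose an interior vertex $\alpha$ with $\mathrm{in}(\alpha)=(\gamma_1,\dots,\gamma_k)$ and a consecutive block $(\gamma_{p+1},\dots,\gamma_{p+l})$,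 $2\le l<k$, and replace this block in $\mathrm{in}(\alpha)$ by one new vertex $v$ with $\mathrm{in}(v)=(\gamma_{p+1},\dots,\gamma_{p+l})$. Order: $T'\le T$ iff $T'$ is obtained from $T$ by a finite (possibly empty) sequence of moves. **Stable tree-pairs.** Let $r\ge1$, $\mathbf n\in\mathbb Z_{\ge0}^r\setminus\{\mathbf0\}$. A stable tree-pair of type $\mathbf n$ is a datum $2T=(T_b\xrightarrow{f}T_s)$ as follows. (i) The bubble tree $T_b$ is an RRT whose edges are each solid or dashed. Its vertices are partitioned as $V_{\mathrm{comp}}\sqcup V_{\mathrm{seam}}\sqcup V_{\mathrm{mark}}$, where: each $\alpha\in V_{\mathrm{comp}}$ has at least one solid incoming edge, no dashed incoming edge, and either a dashed outgoing edge or no outgoing edge; each $\alpha\in V_{\mathrm{seam}}$ has $\ge0$ dashed incoming edges, no solid incoming edge, and a solid outgoing edge; each $\alpha\in V_{\mathrm{mark}}$ has no incoming edge and either a dashed outgoing edge or no outgoing edge. Write $V_{\mathrm{comp}}=V_{\mathrm{comp}}^1\sqcup V_{\mathrm{comp}}^{\ge2}$ according to the number of incoming edges. Stability: if $\alpha\in V^1_{\mathrm{comp}}$ has $\mathrm{in}(\alpha)=(\beta)$ then $\#\mathrm{in}(\beta)\ge2$; if $\alpha\in V_{\mathrm{comp}}^{\ge2}$ has $\mathrm{in}(\alpha)=(\beta_1,\dots,\beta_\ell)$ then some $\#\mathrm{in}(\beta_j)\ge1$. (ii) The seam tree $T_s$ is an element of $K_r^{\mathrm{tree}}$. (iii) The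 coherence map $f\colon T_b\to T_s$ is a map of vertex sets such that: $f$ sends root to root, and if $\beta\in\mathrm{in}(\alpha)$ then $f(\beta)\in\mathrm{in}(f(\alpha))$ or $f(\beta)=f(\alpha)$; $f$ contracts (sends both endpoints to the same vertex) all dashed edges and every solid edge whose terminal vertex (the endpoint closer to the root) lies in $V^1_{\mathrm{comp}}$; for $\alpha\in V_{\mathrm{comp}}^{\ge2}$, $f$ maps $\mathrm{in}(\alpha)$ bijectively and order-preservingly onto $\mathrm{in}(f(\alpha))$; $f$ sends every element of $V_{\mathrm{mark}}$ to a leaf of $T_s$, and $f^{-1}\{\lambda_i\}$ contains exactly $n_i$ elements of $V_{\mathrm{mark}}$, denoted $\mu_{i1},\dots,\mu_{in_i}$ in left-to-right order. $W^{\mathrm{tree}}_{\mathbf n}$ is the set of isomorphism classes of stable tree-pairs of type $\mathbf n$ (isomorphisms are pairs of isomorphisms of bubble trees and of seam trees, respecting all structure and commuting with the coherence maps). **Moves on tree-pairs.** In general there are three types of moves. Type 1: choose $\alpha\in V_{\mathrm{comp}}(T_b)$, $\beta\in\mathrm{in}(\alpha)$ with $\mathrm{in}(\beta)=(\gamma_1,\dots,\gamma_k)$, and a consecutive block $(\gamma_{p+1},\dots,\gamma_{p+l})$ with $2\le l<k$ if $\#\mathrm{in}(\alpha)=1$ and $2\le l\le k$ if $\#\mathrm{in}(\alpha)\ge2$. Replace the block in $\mathrm{in}(\beta)$ by one new vertex $\delta\in V_{\mathrm{comp}}$ (dashed edge to $\beta$), which has a single incoming neighbor, a new vertex $\epsilon\in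 V_{\mathrm{seam}}$ (solid edge), with $\mathrm{in}(\epsilon)=(\gamma_{p+1},\dots,\gamma_{p+l})$ (dashed edges). $T_s$ is unchanged; $f(\delta)=f(\epsilon)=f(\beta)$. Type 2: these moves perform a move on the seam tree $T_s$ (and modify $T_b$ accordingly), so they require an interior vertex of $T_s$ with at least 3 incoming neighbors; there is none when $r\le2$, so type-2 moves do not occur for the types $(n)$, $(n,0)$, $(0,n)$ considered here. Type 3: choose $\alpha\in V_{\mathrm{comp}}^{\ge2}(T_b)$ with $\mathrm{in}(\alpha)=(\beta_1,\dots,\beta_k)$, an integer $q\ge2$, and a decomposition $(\#\mathrm{in}(\beta_1),\dots,\#\mathrm{in}(\beta_k))=\mathbf b^1+\cdots+\mathbf b^q$ with $\mathbf b^1,\dots,\mathbf b^q\in\mathbb Z_{\ge0}^k\setminus\{\mathbf 0\}$. Replace the incoming structure of $\alpha$ so that $\alpha$ has a single incoming neighbor, a new vertex $\epsilon\in V_{\mathrm{seam}}$ (solid edge); $\mathrm{in}(\epsilon)=(\delta_1,\dots,\delta_q)$ (dashed edges) with new vertices $\delta_j\in V_{\mathrm{comp}}^{\ge2}$; $\mathrm{in}(\delta_j)=(\beta_{j1},\dots,\beta_{jk})$ (solid edges) with $\beta_{ji}\in V_{\mathrm{seam}}$; and, for each $i$, the sequence $\mathrm{in}(\beta_i)$ is cut, in order, into consecutive blocks of lengths $b^1_i,\dots,b^q_i$, the $j$-th of which is $\mathrm{in}(\beta_{ji})$ (dashed edges). $T_s$ is unchanged; $f(\epsilon)=f(\delta_j)=f(\alpha)$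 and $f(\beta_{ji})=f(\beta_i)$. The partial order on $W_{\mathbf n}^{\mathrm{tree}}$: $2T'\le 2T$ iff $2T'$ is obtained from $2T$ by a finite (possibly empty) sequence of moves. **The multiplihedron $J_n$.** Here $J_n$ denotes the poset of nonempty faces of the $(n-1)$-dimensional multiplihedron, in its standard description by colored (painted) trees. An element is an isomorphism class of RRTs with $n$ leaves together with a set of colored interior vertices such that the path from each leaf to the root contains exactly one colored vertex, every uncolored interior vertex has at least 2 incoming neighbors, and every colored vertex has at least 1 incoming neighbor. The order: $T'\le T$ iff $T'$ is obtained from $T$ by a finite (possibly empty) sequence of the following operations: (a) at an uncolored interior vertex with $k$ incoming neighbors, replace a consecutive block of $l$ of them, $2\le l<k$, by a new uncolored vertex whose incoming neighbors are that block; (b) the same at a colored vertex with $k$ incoming neighbors, with $2\le l\le k$; (c) at a colored vertex $v$, cut $\mathrm{in}(v)$ into $q\ge2$ consecutive nonempty blocks, make $v$ uncolored, and give it as incoming neighbors $q$ new colored vertices whose incoming neighbors are these blocks in order. *)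

theory Defs
  imports Main "HOL-Library.Sublist"
begin

section \<open>Rooted ribbon trees\<close>

text \<open>
  A finite rooted ribbon tree whose vertices carry decorations in \<open>'a\<close>; the list \<open>inc\<close> is the
  sequence of incoming neighbours. Each isomorphism class of (decorated) rooted ribbon trees is
  represented by exactly one value of this type, and a rooted ribbon tree has no automorphism
  besides the identity, so isomorphism is equality. Undecorated trees are of type
  \<open>unit rrt\<close>.
\<close>

datatype 'a rrt = Node (dec: 'a) (inc: "'a rrt list")

text \<open>
  A vertex is named by the path of child indices that leads to it from the root; \<open>verts\<close> lists
  the vertices in depth-first left-to-right order. The term \<open>subtree_at T p\<close> is meaningful only
  for \<open>p \<in> set (verts T)\<close>.
\<close>

primrec verts :: "'a rrt \<Rightarrow> nat list list" where
  "verts (Node a ts) =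
     [] # concat (map2 (\<lambda>i ps. map ((#) i) ps) [0..<length ts] (map verts ts))"

primrec subtree_at :: "'a rrt \<Rightarrow> nat list \<Rightarrow> 'a rrt" where
  "subtree_at T [] = T"
| "subtree_at T (i # p) = subtree_at (inc T ! i) p"

definition subtrees :: "'a rrt \<Rightarrow> 'a rrt list" where
  "subtrees T = map (subtree_at T) (verts T)"

definition in_verts :: "'a rrt \<Rightarrow> nat list \<Rightarrow> nat list list" where
  "in_verts T p = map (\<lambda>i. p @ [i]) [0..<length (inc (subtree_at T p))]"

definition leaves :: "'a rrt \<Rightarrow> nat list list" where
  "leaves T = filter (\<lambda>p. in_verts T p = []) (verts T)"

text \<open>\<open>at_vertex R T T'\<close>: the operation \<open>R\<close> is performed at some vertex of \<open>T\<close>.\<close>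

inductive at_vertex :: "('a rrt \<Rightarrow> 'a rrt \<Rightarrow> bool) \<Rightarrow> 'a rrt \<Rightarrow> 'a rrt \<Rightarrow> bool"
  for R where
  here: "R T T' \<Longrightarrow> at_vertex R T T'"
| below: "at_vertex R T T' \<Longrightarrow> at_vertex R (Node a (xs @ T # ys)) (Node a (xs @ T' # ys))"


section \<open>The posets of stable rooted ribbon trees\<close>

definition stable :: "unit rrt \<Rightarrow> bool" where
  "stable T \<longleftrightarrow> (\<forall>t\<in>set (subtrees T). inc t \<noteq> [] \<longrightarrow> 2 \<le> length (inc t))"

definition K_tree :: "nat \<Rightarrow> unit rrt set" where
  "K_tree r = {T. stable T \<and> length (leaves T) = r}"

inductive K_move :: "unit rrt \<Rightarrow> unit rrt \<Rightarrow> bool" where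
  "2 \<le> length block \<Longrightarrow> length block < length (xs @ block @ ys) \<Longrightarrow>
   K_move (Node () (xs @ block @ ys)) (Node () (xs @ Node () block # ys))"

definition K_le :: "unit rrt \<Rightarrow> unit rrt \<Rightarrow> bool" where
  "K_le T' T \<longleftrightarrow> (at_vertex K_move)\<^sup>*\<^sup>* T T'"


section \<open>Stable tree-pairs\<close>

datatype vkind = Comp | Seam | Mark
datatype style = Solid | Dashed

text \<open>
  A vertex of the bubble tree carries its class, the style of its outgoing edge (\<open>None\<close> exactly
  at the root, which has no outgoing edge), and its image under the coherence map, a vertex of
  the seam tree. A bubble tree decorated in this way is a bubble tree together with an arbitrary
  map from its vertices to seam tree vertices.
\<close>

datatype bvertex = BVertex (kind: vkind) (out: "style option") (coh: "nat list")

type_synonym tree_pair = "bvertex rrt \<times> unit rrt"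

abbreviation tkind :: "bvertex rrt \<Rightarrow> vkind" where "tkind t \<equiv> kind (dec t)"
abbreviation tout :: "bvertex rrt \<Rightarrow> style option" where "tout t \<equiv> out (dec t)"
abbreviation tcoh :: "bvertex rrt \<Rightarrow> nat list" where "tcoh t \<equiv> coh (dec t)"

definition bubble_tree :: "bvertex rrt \<Rightarrow> bool" where
  "bubble_tree B \<longleftrightarrow>
     tout B = None \<and>
     (\<forall>t\<in>set (subtrees B).
        (\<forall>s\<in>set (inc t). tout s \<noteq> None) \<and>
        (case tkind t of
           Comp \<Rightarrow> (\<exists>s\<in>set (inc t). tout s = Some Solid) \<and>
                   (\<forall>s\<in>set (inc t). tout s \<noteq> Some Dashed) \<and>
                   (tout t = Some Dashed \<or> tout t = None)
         | Seam \<Rightarrow> (\<forall>s\<in>set (inc t). tout s \<noteq> Some Solid) \<and> tout t = Some Solid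
         | Mark \<Rightarrow> inc t = [] \<and> (tout t = Some Dashed \<or> tout t = None)))"

definition stable_bubble :: "bvertex rrt \<Rightarrow> bool" where
  "stable_bubble B \<longleftrightarrow>
     (\<forall>t\<in>set (subtrees B). tkind t = Comp \<longrightarrow>
        (\<forall>s. inc t = [s] \<longrightarrow> 2 \<le> length (inc s)) \<and>
        (2 \<le> length (inc t) \<longrightarrow> (\<exists>s\<in>set (inc t). 1 \<le> length (inc s))))"

text \<open>
  For a component vertex with at least two incoming neighbours, the order-preserving bijection
  onto the incoming neighbours of the image is expressed as an equality of sequences.
\<close>

definition coherent :: "bvertex rrt \<Rightarrow> unit rrt \<Rightarrow> bool" where
  "coherent B S \<longleftrightarrow>
     tcoh B = [] \<and>
     (\<forall>t\<in>set (subtrees B).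
        tcoh t \<in> set (verts S) \<and>
        (\<forall>s\<in>set (inc t).
           (tcoh s \<in> set (in_verts S (tcoh t)) \<or> tcoh s = tcoh t) \<and>
           (tout s = Some Dashed \<longrightarrow> tcoh s = tcoh t) \<and>
           (tout s = Some Solid \<and> tkind t = Comp \<and> length (inc t) = 1 \<longrightarrow> tcoh s = tcoh t)) \<and>
        (tkind t = Comp \<and> 2 \<le> length (inc t) \<longrightarrow> map tcoh (inc t) = in_verts S (tcoh t)) \<and>
        (tkind t = Mark \<longrightarrow> tcoh t \<in> set (leaves S)))"

text \<open>The type of a tree-pair is a list \<open>n\<close>, whose length is the number of seam tree leaves.\<close>

definition W_tree :: "nat list \<Rightarrow> tree_pair set" where
  "W_tree n = {(B, S).
     bubble_tree B \<and> stable_bubble B \<and> S \<in> K_tree (length n) \<and> coherent B S \<and>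
     (\<forall>i<length n.
        length (filter (\<lambda>t. tkind t = Mark \<and> tcoh t = leaves S ! i) (subtrees B)) = n ! i)}"

text \<open>
  In a type 1 move, \<open>a\<close>, \<open>b\<close> decorate the chosen vertices \<open>\<alpha>\<close> and \<open>\<beta>\<close>; the premises are
  \<open>2 \<le> l < k\<close> if \<open>\<alpha>\<close> has one incoming neighbour and \<open>2 \<le> l \<le> k\<close> otherwise.
\<close>

inductive W_move1 :: "bvertex rrt \<Rightarrow> bvertex rrt \<Rightarrow> bool" where
  "kind a = Comp \<Longrightarrow>
   2 \<le> length block \<Longrightarrow>
   (length (xs @ Node b (us @ block @ ws) # ys) = 1 \<longrightarrow>
      length block < length (us @ block @ ws)) \<Longrightarrow>
   W_move1
     (Node a (xs @ Node b (us @ block @ ws) # ys))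
     (Node a (xs @ Node b (us @ Node (BVertex Comp (Some Dashed) (coh b))
                                  [Node (BVertex Seam (Some Solid) (coh b)) block] # ws) # ys))"

text \<open>
  In a type 3 move at a vertex with incoming neighbours \<open>\<beta>s\<close>, the entry \<open>C ! j ! i\<close> is the
  \<open>j\<close>-th block cut from the incoming sequence of \<open>\<beta>s ! i\<close>. The decomposition into
  \<open>\<^bold>b\<^sup>1 + \<cdots> + \<^bold>b\<^sup>q\<close> is given by the lengths of the blocks, so \<open>\<^bold>b\<^sup>j \<noteq> 0\<close> says that some block in
  \<open>C ! j\<close> is nonempty.
\<close>

inductive W_move3 :: "bvertex rrt \<Rightarrow> bvertex rrt \<Rightarrow> bool" where
  "kind a = Comp \<Longrightarrow>
   2 \<le> length \<beta>s \<Longrightarrow>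
   2 \<le> length C \<Longrightarrow>
   (\<forall>c\<in>set C. length c = length \<beta>s \<and> (\<exists>block\<in>set c. block \<noteq> [])) \<Longrightarrow>
   (\<forall>i<length \<beta>s. concat (map (\<lambda>c. c ! i) C) = inc (\<beta>s ! i)) \<Longrightarrow>
   W_move3
     (Node a \<beta>s)
     (Node a [Node (BVertex Seam (Some Solid) (coh a))
        (map (\<lambda>c. Node (BVertex Comp (Some Dashed) (coh a))
                     (map2 (\<lambda>\<beta> block. Node (BVertex Seam (Some Solid) (tcoh \<beta>)) block) \<beta>s c)) C)])"

text \<open>
  The order for seam trees with at most two leaves. The remaining moves, which change the seam
  tree, need a vertex of the seam tree with at least three incoming neighbours and are omitted;
  thus \<open>W_le\<close> is the order on \<open>W_tree n\<close> only if \<open>length n \<le> 2\<close>.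
\<close>

definition W_move :: "tree_pair \<Rightarrow> tree_pair \<Rightarrow> bool" where
  "W_move P P' \<longleftrightarrow>
     snd P' = snd P \<and>
     (at_vertex W_move1 (fst P) (fst P') \<or> at_vertex W_move3 (fst P) (fst P'))"

definition W_le :: "tree_pair \<Rightarrow> tree_pair \<Rightarrow> bool" where
  "W_le P' P \<longleftrightarrow> W_move\<^sup>*\<^sup>* P P'"


section \<open>The face poset of the multiplihedron\<close>

datatype color = Colored | Uncolored

text \<open>Only interior vertices can be colored, so leaves are decorated by \<open>Uncolored\<close>.\<close>

definition J_tree :: "nat \<Rightarrow> color rrt set" where
  "J_tree n = {T.
     length (leaves T) = n \<and>
     (\<forall>t\<in>set (subtrees T). inc t = [] \<longrightarrow> dec t = Uncolored) \<and>
     (\<forall>p\<in>set (leaves T). \<exists>!q. prefix q p \<and> dec (subtree_at T q) = Colored) \<and>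
     (\<forall>t\<in>set (subtrees T). inc t \<noteq> [] \<and> dec t = Uncolored \<longrightarrow> 2 \<le> length (inc t)) \<and>
     (\<forall>t\<in>set (subtrees T). dec t = Colored \<longrightarrow> 1 \<le> length (inc t))}"

inductive J_move :: "color rrt \<Rightarrow> color rrt \<Rightarrow> bool" where
  uncolored:
    "2 \<le> length block \<Longrightarrow> length block < length (xs @ block @ ys) \<Longrightarrow>
     J_move (Node Uncolored (xs @ block @ ys)) (Node Uncolored (xs @ Node Uncolored block # ys))"
| colored:
    "2 \<le> length block \<Longrightarrow>
     J_move (Node Colored (xs @ block @ ys)) (Node Colored (xs @ Node Uncolored block # ys))"
| split:
    "2 \<le> length blocks \<Longrightarrow> (\<forall>block\<in>set blocks. block \<noteq> []) \<Longrightarrow>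
     J_move (Node Colored (concat blocks)) (Node Uncolored (map (Node Colored) blocks))"

definition J_le :: "color rrt \<Rightarrow> color rrt \<Rightarrow> bool" where
  "J_le T' T \<longleftrightarrow> (at_vertex J_move)\<^sup>*\<^sup>* T T'"


section \<open>Isomorphisms of posets\<close>

definition poset :: "'a set \<Rightarrow> ('a \<Rightarrow> 'a \<Rightarrow> bool) \<Rightarrow> bool" where
  "poset A le \<longleftrightarrow> reflp_on A le \<and> transp_on A le \<and> antisymp_on A le"

definition poset_isomorphic ::
  "'a set \<Rightarrow> ('a \<Rightarrow> 'a \<Rightarrow> bool) \<Rightarrow> 'b set \<Rightarrow> ('b \<Rightarrow> 'b \<Rightarrow> bool) \<Rightarrow> bool" where
  "poset_isomorphic A leA B leB \<longleftrightarrow>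
     poset A leA \<and> poset B leB \<and>
     (\<exists>\<phi>. bij_betw \<phi> A B \<and> (\<forall>x\<in>A. \<forall>y\<in>A. leA x y \<longleftrightarrow> leB (\<phi> x) (\<phi> y)))"

end

theory Submission imports Defs begin

text \<open>
  Over a leaf of the seam tree every component vertex has a single seam below it, so a bubble
  tree there is a stable tree in which each interior vertex is doubled into a component and a
  seam. For \<open>r = 1\<close> this is the whole bubble tree. For \<open>r = 2\<close> the seam tree is a cherry, and the
  component vertices over its root with two seams are the colored vertices: one of the seams
  has no incoming edges, since a stable tree has a leaf and the corresponding leaf of the cherry
  carries no marks. These encodings match moves with moves, and moves increase the number of
  vertices, which gives antisymmetry.
\<close>

section \<open>Recursion over trees\<close>

text \<open>Moves apply to arbitrary decorated trees, not only to tree-pairs, so a chain of moves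
  between two elements of \<open>W_tree\<close> could a priori leave the encoded trees. Each
  encoding is therefore shown to be a simulation in both directions: a bubble tree \<open>B\<close>
  arises by one move from an encoded tree iff \<open>B\<close> encodes a tree that arises by one
  move. Chains that start at an encoding then stay among encodings. The simulations hold for all
  stable or painted trees; the number of leaves enters only when the image is compared with
  \<open>W_tree\<close>.

  Moves match because of the number of seams at a component vertex. With one seam, type 1 has the
  bound \<open>l < k\<close> of operation (a), and type 3 is impossible. With two seams, one of them
  empty, type 1 has the bound \<open>l \<le> k\<close> of operation (b), and type 3 is operation
  (c): a nonzero vector is a nonempty block of the seam that has incoming edges.

  The definitions quantify over all vertices or over all paths to leaves, whereas the encodings are
  recursive. Hence most of the work is to bring every condition into a form that recurses over the
  children of the root.\<close>

lemma verts_Node: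
  "verts (Node a ts) = [] # concat (map (\<lambda>i. map ((#) i) (verts (ts ! i))) [0..<length ts])"
proof -
  have "map2 (\<lambda>i ps. map ((#) i) ps) [0..<length ts] (map verts ts)
      = map (\<lambda>i. map ((#) i) (verts (ts ! i))) [0..<length ts]"
    by (rule nth_equalityI) auto
  then show ?thesis by simp
qed

lemma map_nth_upt: "map (\<lambda>i. f (ts ! i)) [0..<length ts] = map f ts"
  by (rule nth_equalityI) auto

lemma subtrees_Node: "subtrees (Node a ts) = Node a ts # concat (map subtrees ts)"
proof -
  have "concat (map (\<lambda>i. subtrees (ts ! i)) [0..<length ts]) = concat (map subtrees ts)"
    by (simp only: map_nth_upt)
  then show ?thesis
    unfolding subtrees_def verts_Node by (simp add: map_concat o_def)
qed

lemma leaves_Node: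
  "leaves (Node a ts) =
     (if ts = [] then [[]]
      else concat (map (\<lambda>i. map ((#) i) (leaves (ts ! i))) [0..<length ts]))"
  unfolding leaves_def verts_Node in_verts_def
  by (simp add: filter_concat filter_map o_def)

lemma length_leaves_Node:
  "length (leaves (Node a ts)) =
     (if ts = [] then 1 else (\<Sum>t\<leftarrow>ts. length (leaves t)))"
  by (simp add: leaves_Node length_concat o_def map_nth_upt[of "\<lambda>t. length (leaves t)"])

lemma leaves_nonempty: "leaves T \<noteq> []"
proof (induction T)
  case (Node a ts)
  show ?case
  proof (cases ts)
    case Nil
    then show ?thesis by (simp add: leaves_Node)
  next
    case (Cons t us)
    have "length (leaves t) \<noteq> 0" using Node[of t] Cons by simp
    then have "length (leaves (Node a ts)) \<noteq> 0"
      unfolding length_leaves_Node using Cons by simp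
    then show ?thesis by simp
  qed
qed

lemma leaves_Node_Cons:
  "ts \<noteq> [] \<Longrightarrow> q \<in> set (leaves (Node a ts)) \<longleftrightarrow>
     (\<exists>i p. q = i # p \<and> i < length ts \<and> p \<in> set (leaves (ts ! i)))"
  by (auto simp: leaves_Node)

text \<open>Each tree has a leaf. This bounds the branching of seam trees with few leaves, and it
  shows that a sequence of trees without leaves is empty.\<close>

lemma length_le_sum_leaves: "length ts \<le> (\<Sum>t\<leftarrow>ts. length (leaves t))"
proof (induction ts)
  case (Cons t ts)
  have "1 \<le> length (leaves t)" using leaves_nonempty[of t] by (simp add: Suc_le_eq)
  then show ?case using Cons by simp
qed simp

text \<open>The part of \<open>at_vertex\<close> that acts away from the root, stated on the
  sequence of children alone so that it commutes with \<open>map\<close> and with cons.\<close>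

definition children_step :: "('a rrt \<Rightarrow> 'a rrt \<Rightarrow> bool) \<Rightarrow> 'a rrt list \<Rightarrow> 'a rrt list \<Rightarrow> bool" where
  "children_step R ts us \<longleftrightarrow>
     (\<exists>xs t ys t'. ts = xs @ t # ys \<and> at_vertex R t t' \<and> us = xs @ t' # ys)"

lemma at_vertex_Node:
  "at_vertex R (Node a ts) T \<longleftrightarrow>
     R (Node a ts) T \<or> (\<exists>us. T = Node a us \<and> children_step R ts us)"
  unfolding children_step_def
  by (subst at_vertex.simps) blast

lemma children_step_Nil [simp]: "\<not> children_step R [] us"
  by (simp add: children_step_def)

lemma children_step_Cons [simp]:
  "children_step R (t # ts) us \<longleftrightarrow>
     (\<exists>t'. at_vertex R t t' \<and> us = t' # ts) \<or> (\<exists>us'. children_step R ts us' \<and> us = t # us')"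
proof
  assume "children_step R (t # ts) us"
  then obtain xs s ys s' where *: "t # ts = xs @ s # ys" "at_vertex R s s'" "us = xs @ s' # ys"
    unfolding children_step_def by blast
  show "(\<exists>t'. at_vertex R t t' \<and> us = t' # ts) \<or> (\<exists>us'. children_step R ts us' \<and> us = t # us')"
  proof (cases xs)
    case Nil
    then show ?thesis using * by auto
  next
    case (Cons x xs')
    then have "children_step R ts (xs' @ s' # ys)"
      unfolding children_step_def using * by auto
    then show ?thesis using Cons * by auto
  qed
next
  assume "(\<exists>t'. at_vertex R t t' \<and> us = t' # ts) \<or> (\<exists>us'. children_step R ts us' \<and> us = t # us')"
  then show "children_step R (t # ts) us"
  proof (elim disjE exE conjE)
    fix t' assume "at_vertex R t t'" "us = t' # ts"
    then show ?thesis
      unfolding children_step_def by (intro exI[of _ "[]"]) auto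
  next
    fix us' assume "children_step R ts us'" "us = t # us'"
    then obtain xs s ys s' where "ts = xs @ s # ys" "at_vertex R s s'" "us = t # xs @ s' # ys"
      unfolding children_step_def by blast
    then show ?thesis
      unfolding children_step_def by (intro exI[of _ "t # xs"]) auto
  qed
qed

lemma children_step_length: "children_step R ts us \<Longrightarrow> length us = length ts"
  by (auto simp: children_step_def)

lemma children_step_all:
  assumes "children_step R ts us" "\<forall>t\<in>set ts. P t"
    and "\<And>t t'. t \<in> set ts \<Longrightarrow> at_vertex R t t' \<Longrightarrow> P t \<Longrightarrow> P t'"
  shows "\<forall>t\<in>set us. P t"
proof -
  obtain xs t ys t' where "ts = xs @ t # ys" "at_vertex R t t'" "us = xs @ t' # ys"
    using assms(1) unfolding children_step_def by blast
  with assms(2,3) show ?thesis by auto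
qed

text \<open>A simulation of moves by \<open>f\<close> on the members of \<open>ts\<close> lifts to
  the sequence. The premise speaks of these members only, so an induction hypothesis on the children
  can be supplied directly.\<close>

lemma children_step_map:
  assumes "\<And>t b. t \<in> set ts \<Longrightarrow> at_vertex R (f t) b \<longleftrightarrow> (\<exists>t'. at_vertex Q t t' \<and> b = f t')"
  shows "children_step R (map f ts) bs \<longleftrightarrow> (\<exists>us. children_step Q ts us \<and> bs = map f us)"
  using assms
proof (induction ts arbitrary: bs)
  case (Cons t ts)
  have IH: "children_step R (map f ts) cs \<longleftrightarrow> (\<exists>us. children_step Q ts us \<and> cs = map f us)" for cs
    by (rule Cons.IH) (rule Cons.prems, simp)
  have hd: "at_vertex R (f t) b \<longleftrightarrow> (\<exists>t'. at_vertex Q t t' \<and> b = f t')" for b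
    by (rule Cons.prems) simp
  show ?case
    unfolding list.map children_step_Cons IH hd by fastforce
qed simp

text \<open>\<open>W_move\<close> asks for a type 1 move somewhere or a type 3 move somewhere.
  Merging the two relations lets one induction treat both types.\<close>

lemma at_vertex_disj:
  "at_vertex (\<lambda>t t'. R t t' \<or> Q t t') T T' \<longleftrightarrow> at_vertex R T T' \<or> at_vertex Q T T'"
proof
  show "at_vertex (\<lambda>t t'. R t t' \<or> Q t t') T T' \<Longrightarrow> at_vertex R T T' \<or> at_vertex Q T T'"
    by (induction rule: at_vertex.induct) (auto intro: at_vertex.intros)
next
  have "at_vertex R T T' \<Longrightarrow> at_vertex (\<lambda>t t'. R t t' \<or> Q t t') T T'"
    by (induction rule: at_vertex.induct) (auto intro: at_vertex.intros)
  moreover have "at_vertex Q T T' \<Longrightarrow> at_vertex (\<lambda>t t'. R t t' \<or> Q t t') T T'"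
    by (induction rule: at_vertex.induct) (auto intro: at_vertex.intros)
  ultimately show "at_vertex R T T' \<or> at_vertex Q T T' \<Longrightarrow> at_vertex (\<lambda>t t'. R t t' \<or> Q t t') T T'"
    by blast
qed

lemma at_vertex_increasing:
  assumes "at_vertex R T T'"
    and "\<And>t t'. R t t' \<Longrightarrow> length (subtrees t) < length (subtrees t')"
  shows "length (subtrees T) < length (subtrees T')"
  using assms(1) by induction (auto simp: subtrees_Node assms(2))


section \<open>Posets generated by steps\<close>

lemma poset_steps:
  fixes m :: "'a \<Rightarrow> nat"
  assumes "\<And>x y. step x y \<Longrightarrow> m x < m y"
  shows "poset A (\<lambda>y x. step\<^sup>*\<^sup>* x y)"
proof -
  have mono: "m x < m y \<or> x = y" if "step\<^sup>*\<^sup>* x y" for x y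
    using that by (induction rule: rtranclp_induct) (use assms in fastforce)+
  then have "x = y" if "step\<^sup>*\<^sup>* x y" "step\<^sup>*\<^sup>* y x" for x y
    using mono[OF that(1)] mono[OF that(2)] by auto
  then show ?thesis
    unfolding poset_def
    by (auto intro!: reflp_onI transp_onI antisymp_onI)
qed

lemma poset_isomorphic_sym:
  assumes "poset_isomorphic A le B le'"
  shows "poset_isomorphic B le' A le"
proof -
  obtain f where f: "bij_betw f A B" "\<forall>x\<in>A. \<forall>y\<in>A. le x y \<longleftrightarrow> le' (f x) (f y)"
    using assms by (auto simp: poset_isomorphic_def)
  let ?g = "inv_into A f"
  have "bij_betw ?g B A" using f(1) by (rule bij_betw_inv_into)
  moreover have "le' x y \<longleftrightarrow> le (?g x) (?g y)" if "x \<in> B" "y \<in> B" for x y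
    using that f bij_betw_inv_into_right[OF f(1)] bij_betwE[OF \<open>bij_betw ?g B A\<close>] by simp
  ultimately show ?thesis
    using assms unfolding poset_isomorphic_def by blast
qed

text \<open>An isomorphism must join two posets, but a measure is available on one side only; the
  order axioms are transported to the other, so \<open>W_move\<close> needs no measure of its
  own.\<close>

lemma poset_bij_betw:
  assumes "poset A le" "bij_betw f A B" "\<forall>x\<in>A. \<forall>y\<in>A. le x y \<longleftrightarrow> le' (f x) (f y)"
  shows "poset B le'"
proof -
  have B: "B = f ` A" using assms(2) by (simp add: bij_betw_def)
  have "reflp_on B le'"
    using assms(1,3) unfolding poset_def B by (auto simp: reflp_on_def)
  moreover have "transp_on B le'"
  proof (rule transp_onI)
    fix x y z assume "x \<in> B" "y \<in> B" "z \<in> B" "le' x y" "le' y z"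
    then obtain x' y' z' where
      *: "x' \<in> A" "y' \<in> A" "z' \<in> A" "x = f x'" "y = f y'" "z = f z'"
      unfolding B by blast
    with \<open>le' x y\<close> \<open>le' y z\<close> assms(3) have "le x' y'" "le y' z'" by auto
    then have "le x' z'" using assms(1) * unfolding poset_def by (blast dest: transp_onD)
    then show "le' x z" using assms(3) * by auto
  qed
  moreover have "antisymp_on B le'"
  proof (rule antisymp_onI)
    fix x y assume "x \<in> B" "y \<in> B" "le' x y" "le' y x"
    then obtain x' y' where *: "x' \<in> A" "y' \<in> A" "x = f x'" "y = f y'"
      unfolding B by blast
    with \<open>le' x y\<close> \<open>le' y x\<close> assms(3) have "le x' y'" "le y' x'" by auto
    then have "x' = y'" using assms(1) * unfolding poset_def by (blast dest: antisymp_onD)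
    then show "x = y" using * by simp
  qed
  ultimately show ?thesis by (simp add: poset_def)
qed

text \<open>By \<open>sim\<close>, a chain from \<open>f x\<close> lifts step by step to a chain
  from \<open>x\<close> inside \<open>I\<close>. Its end has the same image as \<open>y\<close>, and
  injectivity on \<open>I\<close> identifies the two.\<close>

lemma rtranclp_bisimulation:
  assumes inj: "inj_on f I"
    and inv: "\<And>x y. x \<in> I \<Longrightarrow> step x y \<Longrightarrow> y \<in> I"
    and sim: "\<And>x b. x \<in> I \<Longrightarrow> step' (f x) b \<longleftrightarrow> (\<exists>y. step x y \<and> b = f y)"
    and "x \<in> I" "y \<in> I"
  shows "step'\<^sup>*\<^sup>* (f x) (f y) \<longleftrightarrow> step\<^sup>*\<^sup>* x y"
proof
  have "\<exists>z\<in>I. step\<^sup>*\<^sup>* x z \<and> b = f z" if "step'\<^sup>*\<^sup>* (f x) b" for b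
    using that
  proof (induction rule: rtranclp_induct)
    case base
    then show ?case using \<open>x \<in> I\<close> by blast
  next
    case (step b b')
    then obtain z where "z \<in> I" "step\<^sup>*\<^sup>* x z" "b = f z" by blast
    moreover from this obtain z' where "step z z'" "b' = f z'"
      using sim step(2) by blast
    ultimately show ?case using inv[of z z'] rtranclp.rtrancl_into_rtrancl by metis
  qed
  then show "step'\<^sup>*\<^sup>* (f x) (f y) \<Longrightarrow> step\<^sup>*\<^sup>* x y"
    using inj \<open>y \<in> I\<close> by (metis inj_onD)
next
  have "z \<in> I \<and> step'\<^sup>*\<^sup>* (f x) (f z)" if "step\<^sup>*\<^sup>* x z" for z
    using that
  proof (induction rule: rtranclp_induct)
    case base
    then show ?case using \<open>x \<in> I\<close> by simp
  next
    case (step z z')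
    then show ?case using sim[of z "f z'"] inv[of z z'] by (auto intro: rtranclp.rtrancl_into_rtrancl)
  qed
  then show "step\<^sup>*\<^sup>* x y \<Longrightarrow> step'\<^sup>*\<^sup>* (f x) (f y)" by blast
qed

text \<open>\<open>I\<close> carries the shape condition and is closed under steps, while
  \<open>A\<close> may also fix the number of leaves. Closure of \<open>A\<close> itself is not
  asked for.\<close>

lemma poset_isomorphic_steps:
  fixes m :: "'a \<Rightarrow> nat"
  assumes incr: "\<And>x y. step x y \<Longrightarrow> m x < m y"
    and inj: "inj_on f I"
    and inv: "\<And>x y. x \<in> I \<Longrightarrow> step x y \<Longrightarrow> y \<in> I"
    and sim: "\<And>x b. x \<in> I \<Longrightarrow> step' (f x) b \<longleftrightarrow> (\<exists>y. step x y \<and> b = f y)"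
    and sub: "A \<subseteq> I" and img: "B = f ` A"
  shows "poset_isomorphic A (\<lambda>y x. step\<^sup>*\<^sup>* x y) B (\<lambda>y x. step'\<^sup>*\<^sup>* x y)"
proof -
  have "bij_betw f A B"
    using inj sub img by (auto simp: bij_betw_def intro: inj_on_subset)
  moreover have "step'\<^sup>*\<^sup>* (f y) (f x) \<longleftrightarrow> step\<^sup>*\<^sup>* y x" if "x \<in> A" "y \<in> A" for x y
    by (rule rtranclp_bisimulation[of f I]) (use inj inv sim sub that in auto)
  then have "\<forall>x\<in>A. \<forall>y\<in>A. step\<^sup>*\<^sup>* y x \<longleftrightarrow> step'\<^sup>*\<^sup>* (f y) (f x)"
    by simp
  moreover have "poset A (\<lambda>y x. step\<^sup>*\<^sup>* x y)"
    using incr by (rule poset_steps)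
  ultimately show ?thesis
    unfolding poset_isomorphic_def
    using poset_bij_betw[where le' = "\<lambda>y x. step'\<^sup>*\<^sup>* x y"] by (intro conjI exI[of _ f]) auto
qed


section \<open>Stable trees and the bubble trees over a leaf of the seam tree\<close>

text \<open>The decoration is a parameter because these trees occur twice: with \<open>()\<close> as
  the elements of \<open>K_tree\<close>, and with \<open>Uncolored\<close> as the trees hanging from
  colored vertices.\<close>

fun stable_dec :: "'a \<Rightarrow> 'a rrt \<Rightarrow> bool" where
  "stable_dec d (Node a ts) \<longleftrightarrow>
     a = d \<and> (ts \<noteq> [] \<longrightarrow> 2 \<le> length ts) \<and> (\<forall>t\<in>set ts. stable_dec d t)"

inductive block_move :: "'a \<Rightarrow> 'a rrt \<Rightarrow> 'a rrt \<Rightarrow> bool" for d where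
  "2 \<le> length block \<Longrightarrow> length block < length (xs @ block @ ys) \<Longrightarrow>
   block_move d (Node d (xs @ block @ ys)) (Node d (xs @ Node d block # ys))"

text \<open>\<open>s\<close> is the style of the edge leaving the root, \<open>None\<close> for a
  whole bubble tree and dashed otherwise; \<open>c\<close> is the seam tree vertex over which
  everything lies. Leaves become marks. The decoration is forgotten, so injectivity needs
  \<open>stable_dec\<close> to restore it.\<close>

primrec enc :: "style option \<Rightarrow> nat list \<Rightarrow> 'a rrt \<Rightarrow> bvertex rrt" where
  "enc s c (Node a ts) =
     (if ts = [] then Node (BVertex Mark s c) []
      else Node (BVertex Comp s c)
             [Node (BVertex Seam (Some Solid) c) (map (enc (Some Dashed) c) ts)])"

lemma enc_inj:
  "stable_dec d T \<Longrightarrow> stable_dec d T' \<Longrightarrow> enc s c T = enc s c T' \<Longrightarrow> T = T'"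
proof (induction T arbitrary: s T')
  case (Node a ts)
  obtain a' ts' where T': "T' = Node a' ts'" by (cases T')
  have "ts = ts'"
  proof (cases "ts = []")
    case True
    then show ?thesis using Node.prems(3) by (simp add: T' split: if_splits)
  next
    case False
    then have "map (enc (Some Dashed) c) ts = map (enc (Some Dashed) c) ts'"
      using Node.prems(3) by (simp add: T' split: if_splits)
    moreover have "\<forall>t\<in>set ts. stable_dec d t" "\<forall>t\<in>set ts'. stable_dec d t"
      using Node.prems by (auto simp: T')
    ultimately show ?thesis
      using list.inj_map_strong[of ts ts' "enc (Some Dashed) c" "enc (Some Dashed) c"] Node.IH
      by metis
  qed
  moreover have "a = a'" using Node.prems(1,2) by (simp add: T')
  ultimately show ?case by (simp add: T')
qed

section \<open>Moves at a component vertex with a single seam\<close>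

lemma W_move1_iff:
  "W_move1 (Node a ts) B \<longleftrightarrow> kind a = Comp \<and>
     (\<exists>xs b us block ws ys. ts = xs @ Node b (us @ block @ ws) # ys \<and> 2 \<le> length block \<and>
        (length ts = 1 \<longrightarrow> length block < length (us @ block @ ws)) \<and>
        B = Node a (xs @ Node b (us @ Node (BVertex Comp (Some Dashed) (coh b))
                                  [Node (BVertex Seam (Some Solid) (coh b)) block] # ws) # ys))"
  (is "?L \<longleftrightarrow> kind a = Comp \<and> ?R")
proof
  assume ?L
  then show "kind a = Comp \<and> ?R"
  proof cases
    case (1 block xs b us ws ys)
    have "length ts = 1 \<longrightarrow> length block < length (us @ block @ ws)"
      unfolding 1(1) by (rule 1)
    then show ?thesis
      by (intro conjI exI[of _ xs] exI[of _ b] exI[of _ us] exI[of _ block] exI[of _ ws]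
          exI[of _ ys]) (rule 1 | assumption)+
  qed
next
  assume "kind a = Comp \<and> ?R"
  then show ?L
    by (elim exE conjE) (simp only:, rule W_move1.intros, simp_all)
qed

lemma single_eq_append: "[x] = xs @ y # ys \<longleftrightarrow> xs = [] \<and> y = x \<and> ys = []"
  by (auto simp: Cons_eq_append_conv)

text \<open>With a single seam the premise of the conditional bound holds, so the block is a proper
  part of the sequence, exactly as in a move on stable trees.\<close>

lemma W_move1_single:
  "W_move1 (Node a [Node b ts]) B \<longleftrightarrow> kind a = Comp \<and>
     (\<exists>us block ws. ts = us @ block @ ws \<and> 2 \<le> length block \<and> length block < length ts \<and>
        B = Node a [Node b (us @ Node (BVertex Comp (Some Dashed) (coh b))
                                  [Node (BVertex Seam (Some Solid) (coh b)) block] # ws)])"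
  (is "?L \<longleftrightarrow> kind a = Comp \<and> ?R")
proof
  assume ?L
  then show "kind a = Comp \<and> ?R"
  proof cases
    case (1 block xs b' us ws ys)
    then have "xs = []" "ys = []" "b' = b" "ts = us @ block @ ws"
      by (auto simp: single_eq_append Cons_eq_append_conv)
    with 1 show ?thesis
      by (intro conjI exI[of _ us] exI[of _ block] exI[of _ ws]) simp_all
  qed
next
  assume "kind a = Comp \<and> ?R"
  then obtain us block ws where *: "kind a = Comp" "2 \<le> length block"
      "length block < length (us @ block @ ws)" "ts = us @ block @ ws"
      "B = Node a [Node b (us @ Node (BVertex Comp (Some Dashed) (coh b))
                                  [Node (BVertex Seam (Some Solid) (coh b)) block] # ws)]"
    by (elim exE conjE) (simp only:)
  show ?L
    using W_move1.intros[of a block "[]" b us ws "[]"] * by simp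
qed

lemma W_move3_iff:
  "W_move3 (Node a \<beta>s) B \<longleftrightarrow> kind a = Comp \<and> 2 \<le> length \<beta>s \<and>
     (\<exists>C. 2 \<le> length C \<and>
       (\<forall>c\<in>set C. length c = length \<beta>s \<and> (\<exists>block\<in>set c. block \<noteq> [])) \<and>
       (\<forall>i<length \<beta>s. concat (map (\<lambda>c. c ! i) C) = inc (\<beta>s ! i)) \<and>
       B = Node a [Node (BVertex Seam (Some Solid) (coh a))
        (map (\<lambda>c. Node (BVertex Comp (Some Dashed) (coh a))
                     (map2 (\<lambda>\<beta> block. Node (BVertex Seam (Some Solid) (tcoh \<beta>)) block) \<beta>s c)) C)])"
  (is "?L \<longleftrightarrow> kind a = Comp \<and> 2 \<le> length \<beta>s \<and> ?R")
proof
  assume ?L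
  then show "kind a = Comp \<and> 2 \<le> length \<beta>s \<and> ?R"
  proof cases
    case (1 C)
    show ?thesis by (intro conjI exI[of _ C]) (rule 1)+
  qed
next
  assume "kind a = Comp \<and> 2 \<le> length \<beta>s \<and> ?R"
  then show ?L
    by (elim exE conjE) (simp only:, rule W_move3.intros)
qed

definition bubble_move :: "bvertex rrt \<Rightarrow> bvertex rrt \<Rightarrow> bool" where
  "bubble_move B B' \<longleftrightarrow> W_move1 B B' \<or> W_move3 B B'"

lemma not_bubble_move: "kind a \<noteq> Comp \<Longrightarrow> \<not> bubble_move (Node a ts) B"
  unfolding bubble_move_def W_move1_iff W_move3_iff by (intro notI, elim disjE conjE) (erule notE, assumption)+

lemma bubble_move_Seam:
  "kind b = Seam \<Longrightarrow> at_vertex bubble_move (Node b ts) B \<longleftrightarrow>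
     (\<exists>us. B = Node b us \<and> children_step bubble_move ts us)"
  by (simp add: at_vertex_Node not_bubble_move)

lemma bubble_move_single:
  assumes "kind a = Comp" "kind b = Seam"
  shows "at_vertex bubble_move (Node a [Node b ts]) B \<longleftrightarrow>
     (\<exists>us block ws. ts = us @ block @ ws \<and> 2 \<le> length block \<and> length block < length ts \<and>
        B = Node a [Node b (us @ Node (BVertex Comp (Some Dashed) (coh b))
                                  [Node (BVertex Seam (Some Solid) (coh b)) block] # ws)])
     \<or> (\<exists>us. B = Node a [Node b us] \<and> children_step bubble_move ts us)"
proof -
  have "\<not> W_move3 (Node a [Node b ts]) B"
    unfolding W_move3_iff by simp
  moreover have "(\<exists>bs. B = Node a bs \<and> children_step bubble_move [Node b ts] bs) \<longleftrightarrow>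
      (\<exists>us. B = Node a [Node b us] \<and> children_step bubble_move ts us)"
    by (auto simp: bubble_move_Seam[OF assms(2)])
  ultimately show ?thesis
    unfolding at_vertex_Node[of _ a] bubble_move_def[of "Node a [Node b ts]"] W_move1_single
    using assms(1) by simp
qed

lemma block_move_iff:
  "block_move d (Node a ts) T \<longleftrightarrow> a = d \<and>
     (\<exists>us block ws. ts = us @ block @ ws \<and> 2 \<le> length block \<and> length block < length ts \<and>
        T = Node d (us @ Node d block # ws))"
  by (subst block_move.simps, simp only: rrt.inject, safe) blast+

text \<open>A block chosen in an encoded sequence is the image of a block of the original one, so
  the choice made by a move pulls back along \<open>f\<close>.\<close>

lemma ex_map_append:
  "(\<exists>us vs ws. map f ts = us @ vs @ ws \<and> P us vs ws) \<longleftrightarrow>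
   (\<exists>us vs ws. ts = us @ vs @ ws \<and> P (map f us) (map f vs) (map f ws))"
proof
  assume "\<exists>us vs ws. map f ts = us @ vs @ ws \<and> P us vs ws"
  then obtain us vs ws where *: "map f ts = us @ vs @ ws" "P us vs ws" by blast
  from *(1) obtain us' r where "ts = us' @ r" "us = map f us'" "map f r = vs @ ws"
    by (metis map_eq_append_conv)
  moreover from this(3) obtain vs' ws' where "r = vs' @ ws'" "vs = map f vs'" "ws = map f ws'"
    by (metis map_eq_append_conv)
  ultimately show "\<exists>us vs ws. ts = us @ vs @ ws \<and> P (map f us) (map f vs) (map f ws)"
    using *(2) by metis
next
  assume "\<exists>us vs ws. ts = us @ vs @ ws \<and> P (map f us) (map f vs) (map f ws)"
  then obtain us vs ws where *: "ts = us @ vs @ ws" "P (map f us) (map f vs) (map f ws)" by blast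
  then have "map f ts = map f us @ map f vs @ map f ws" by simp
  with *(2) show "\<exists>us vs ws. map f ts = us @ vs @ ws \<and> P us vs ws" by blast
qed

text \<open>The common induction step of both encodings: over a leaf of the seam tree with
  \<open>f\<close> an \<open>enc\<close>, and at an uncolored vertex with \<open>f\<close> an
  \<open>enc_painted\<close> and \<open>c = []\<close>. \<open>Q\<close> stays open since the moves
  further inside are \<open>block_move\<close> in one case and \<open>J_move\<close> in the
  other.\<close>

lemma bubble_move_map:
  fixes f :: "'a rrt \<Rightarrow> bvertex rrt" and c :: "nat list"
  defines "b \<equiv> BVertex Seam (Some Solid) c"
  assumes a: "kind a = Comp"
    and f: "\<And>block. 2 \<le> length block \<Longrightarrow>
      f (Node d block) = Node (BVertex Comp (Some Dashed) c) [Node b (map f block)]"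
    and ch: "\<And>t B. t \<in> set ts \<Longrightarrow>
      at_vertex bubble_move (f t) B \<longleftrightarrow> (\<exists>t'. at_vertex Q t t' \<and> B = f t')"
  shows "at_vertex bubble_move (Node a [Node b (map f ts)]) B \<longleftrightarrow>
    (\<exists>us. (block_move d (Node d ts) (Node d us) \<or> children_step Q ts us) \<and>
          B = Node a [Node b (map f us)])"
proof -
  define D where "D us block ws \<longleftrightarrow>
    ts = us @ block @ ws \<and> 2 \<le> length block \<and> length block < length ts" for us block ws
  define G where "G us block ws = Node a [Node b (us @
    Node (BVertex Comp (Some Dashed) c) [Node b block] # ws)]" for us block ws
  have b: "kind b = Seam" "coh b = c" by (simp_all add: b_def)
  \<comment> \<open>The bound in \<open>D\<close> makes the assumption on \<open>f\<close>
    applicable: the new pair of a component and a seam is the encoding of the new vertex.\<close>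
  have G: "G (map f us) (map f block) (map f ws) = Node a [Node b (map f (us @ Node d block # ws))]"
    if "D us block ws" for us block ws
    using that by (auto simp: D_def G_def f)
  have ch: "children_step bubble_move (map f ts) bs \<longleftrightarrow>
      (\<exists>us. children_step Q ts us \<and> bs = map f us)" for bs
    by (rule children_step_map) (rule ch)
  have "at_vertex bubble_move (Node a [Node b (map f ts)]) B \<longleftrightarrow>
      (\<exists>us block ws. map f ts = us @ block @ ws \<and> 2 \<le> length block \<and>
          length block < length ts \<and> B = G us block ws)
      \<or> (\<exists>bs. B = Node a [Node b bs] \<and> children_step bubble_move (map f ts) bs)"
    unfolding bubble_move_single[OF a b(1)] G_def b(2) b_def[symmetric] length_map by (rule refl)
  also have "(\<exists>us block ws. map f ts = us @ block @ ws \<and> 2 \<le> length block \<and>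
          length block < length ts \<and> B = G us block ws) \<longleftrightarrow>
      (\<exists>us block ws. D us block ws \<and> B = G (map f us) (map f block) (map f ws))"
    unfolding ex_map_append D_def by (simp only: length_map conj_assoc)
  also have "\<dots> \<longleftrightarrow>
      (\<exists>us block ws. D us block ws \<and> B = Node a [Node b (map f (us @ Node d block # ws))])"
    using G by metis
  also have "\<dots> \<longleftrightarrow>
      (\<exists>us. block_move d (Node d ts) (Node d us) \<and> B = Node a [Node b (map f us)])"
  proof -
    have "block_move d (Node d ts) (Node d us) \<longleftrightarrow>
        (\<exists>vs block ws. D vs block ws \<and> us = vs @ Node d block # ws)" for us
      unfolding block_move_iff D_def by (simp only: rrt.inject conj_assoc simp_thms)
    then show ?thesis by metis
  qed
  also have "(\<exists>bs. B = Node a [Node b bs] \<and> children_step bubble_move (map f ts) bs) \<longleftrightarrow>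
      (\<exists>us. children_step Q ts us \<and> B = Node a [Node b (map f us)])"
    unfolding ch by metis
  finally show ?thesis by metis
qed

lemma at_vertex_block_move:
  "at_vertex (block_move d) (Node d ts) T \<longleftrightarrow>
     (\<exists>us. (block_move d (Node d ts) (Node d us) \<or> children_step (block_move d) ts us) \<and>
           T = Node d us)"
proof -
  have "block_move d (Node d ts) T \<Longrightarrow> \<exists>us. T = Node d us"
    unfolding block_move_iff by metis
  then show ?thesis unfolding at_vertex_Node by metis
qed

lemma block_move_NodeE:
  assumes "block_move d (Node d ts) (Node d us)"
  obtains vs block ws where "ts = vs @ block @ ws" "us = vs @ Node d block # ws"
    "2 \<le> length block" "2 \<le> length us"
proof -
  obtain vs block ws where *: "ts = vs @ block @ ws" "2 \<le> length block"
      "length block < length ts" "us = vs @ Node d block # ws"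
    using assms unfolding block_move_iff rrt.inject by metis
  \<comment> \<open>The block is proper, so at least one old neighbor remains beside the new
    vertex.\<close>
  moreover have "2 \<le> length us" using * by (cases vs; cases ws) simp_all
  ultimately show thesis using that by metis
qed

lemma bubble_move_enc:
  assumes "stable_dec d T"
  shows "at_vertex bubble_move (enc s c T) B \<longleftrightarrow>
     (\<exists>T'. at_vertex (block_move d) T T' \<and> B = enc s c T')"
  using assms
proof (induction T arbitrary: s B)
  case (Node a ts)
  then have [simp]: "a = d" by simp
  show ?case
  proof (cases "ts = []")
    case True
    then show ?thesis
      by (simp add: at_vertex_Node not_bubble_move block_move_iff)
  next
    case False
    let ?f = "enc (Some Dashed) c"
    let ?a = "BVertex Comp s c" and ?b = "BVertex Seam (Some Solid) c"
    have "at_vertex bubble_move (Node ?a [Node ?b (map ?f ts)]) B \<longleftrightarrow>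
      (\<exists>us. (block_move d (Node d ts) (Node d us) \<or> children_step (block_move d) ts us) \<and>
          B = Node ?a [Node ?b (map ?f us)])"
      by (rule bubble_move_map) (use Node in auto)
    \<comment> \<open>No move empties the sequence at the root, so \<open>enc\<close> takes its
      interior branch and does not produce a mark.\<close>
    moreover have "enc s c (Node d us) = Node ?a [Node ?b (map ?f us)]"
      if "block_move d (Node d ts) (Node d us) \<or> children_step (block_move d) ts us" for us
      using that False by (auto elim: block_move_NodeE dest: children_step_length)
    ultimately show ?thesis
      using False unfolding \<open>a = d\<close> at_vertex_block_move by (simp, metis)
  qed
qed

text \<open>The lower bound on the block makes the new vertex stable, and properness of the block
  keeps the old one stable.\<close>

lemma stable_dec_move:
  "at_vertex (block_move d) T T' \<Longrightarrow> stable_dec d T \<Longrightarrow> stable_dec d T'"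
proof (induction T arbitrary: T')
  case (Node a ts)
  then have [simp]: "a = d" by simp
  obtain us where us: "block_move d (Node d ts) (Node d us) \<or> children_step (block_move d) ts us"
      "T' = Node d us"
    using Node.prems(1) unfolding \<open>a = d\<close> at_vertex_block_move by metis
  from us(1) show ?case
  proof
    assume "block_move d (Node d ts) (Node d us)"
    then show ?thesis using Node.prems(2) us(2) by (elim block_move_NodeE) auto
  next
    assume step: "children_step (block_move d) ts us"
    have "\<forall>t\<in>set us. stable_dec d t"
      using step by (rule children_step_all) (use Node in auto)
    then show ?thesis using Node.prems(2) us(2) children_step_length[OF step] by auto
  qed
qed

lemma K_move_eq: "K_move = block_move ()"
  by (intro ext) (simp add: K_move.simps block_move.simps)

lemma block_move_increasing:
  "block_move d T T' \<Longrightarrow> length (subtrees T) < length (subtrees T')"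
  by (auto elim!: block_move.cases simp: subtrees_Node)


section \<open>Painted trees and the bubble trees over a seam tree with two leaves\<close>

text \<open>The recursive form of the path condition on colors. An uncolored root must have
  children, so no path ends before a colored vertex; after a colored vertex only uncolored ones
  follow.\<close>

fun painted :: "color rrt \<Rightarrow> bool" where
  "painted (Node Uncolored ts) \<longleftrightarrow> 2 \<le> length ts \<and> (\<forall>t\<in>set ts. painted t)"
| "painted (Node Colored ts) \<longleftrightarrow> ts \<noteq> [] \<and> (\<forall>t\<in>set ts. stable_dec Uncolored t)"

text \<open>\<open>[0]\<close> and \<open>[1]\<close> are the paths to the two leaves of the cherry,
  and \<open>i\<close> selects the one that carries the marks. Coherence forces the other seam to be
  present even though nothing enters it.\<close>

definition seams :: "nat \<Rightarrow> bvertex rrt list \<Rightarrow> bvertex rrt list" where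
  "seams i ts = [Node (BVertex Seam (Some Solid) [0]) (if i = 0 then ts else []),
                 Node (BVertex Seam (Some Solid) [1]) (if i = 1 then ts else [])]"

text \<open>Uncolored vertices on the root side lie over the root \<open>[]\<close> of the seam
  tree. A colored vertex is where the bubble tree passes to the leaf \<open>[i]\<close>, from which
  point \<open>enc\<close> takes over.\<close>

fun enc_painted :: "nat \<Rightarrow> style option \<Rightarrow> color rrt \<Rightarrow> bvertex rrt" where
  "enc_painted i s (Node Uncolored ts) =
     Node (BVertex Comp s [])
       [Node (BVertex Seam (Some Solid) []) (map (enc_painted i (Some Dashed)) ts)]"
| "enc_painted i s (Node Colored ts) =
     Node (BVertex Comp s []) (seams i (map (enc (Some Dashed) [i]) ts))"

lemma painted_cases [case_names Uncolored Colored]: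
  assumes "painted T"
  obtains ts where "T = Node Uncolored ts" "2 \<le> length ts" "\<forall>t\<in>set ts. painted t"
  | ts where "T = Node Colored ts" "ts \<noteq> []" "\<forall>t\<in>set ts. stable_dec Uncolored t"
  using assms by (cases T rule: painted.cases) auto

lemma seams_inj: "i < 2 \<Longrightarrow> seams i ts = seams i us \<longleftrightarrow> ts = us"
  by (auto simp: seams_def)

lemma enc_painted_inj:
  assumes "i < 2"
  shows "painted T \<Longrightarrow> painted T' \<Longrightarrow> enc_painted i s T = enc_painted i s T' \<Longrightarrow> T = T'"
proof (induction T arbitrary: s T' rule: painted.induct)
  case (1 ts)
  from 1(3) show ?case
  proof (cases rule: painted_cases)
    case (Uncolored us)
    then have "map (enc_painted i (Some Dashed)) ts = map (enc_painted i (Some Dashed)) us"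
      using 1(4) by simp
    moreover have "\<forall>t\<in>set ts. painted t" using 1(2) by simp
    ultimately have "ts = us"
      using list.inj_map_strong[of ts us "enc_painted i (Some Dashed)" "enc_painted i (Some Dashed)"]
        1(1) Uncolored(3) by metis
    then show ?thesis using Uncolored by simp
  next
    case (Colored us)
    \<comment> \<open>An uncolored root yields one seam and a colored root two, so the encodings
      differ.\<close>
    then show ?thesis using 1(4) by (simp add: seams_def)
  qed
next
  case (2 ts)
  from 2(2) show ?case
  proof (cases rule: painted_cases)
    case (Uncolored us)
    then show ?thesis using 2(3) by (simp add: seams_def)
  next
    case (Colored us)
    then have "map (enc (Some Dashed) [i]) ts = map (enc (Some Dashed) [i]) us"
      using 2(3) seams_inj[OF assms] by simp
    moreover have "\<forall>t\<in>set ts. stable_dec Uncolored t" using 2(1) by simp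
    ultimately have "ts = us"
      using list.inj_map_strong[of ts us "enc (Some Dashed) [i]" "enc (Some Dashed) [i]"]
        enc_inj Colored(3) by metis
    then show ?thesis using Colored by simp
  qed
qed

lemma J_move_Uncolored:
  "J_move (Node Uncolored ts) T \<longleftrightarrow> block_move Uncolored (Node Uncolored ts) T"
  by (simp add: J_move.simps block_move.simps)

lemma J_move_Colored:
  "J_move (Node Colored ts) T \<longleftrightarrow>
     (\<exists>us block ws. ts = us @ block @ ws \<and> 2 \<le> length block \<and>
        T = Node Colored (us @ Node Uncolored block # ws)) \<or>
     (\<exists>blocks. ts = concat blocks \<and> 2 \<le> length blocks \<and> (\<forall>block\<in>set blocks. block \<noteq> []) \<and>
        T = Node Uncolored (map (Node Colored) blocks))"
  by (subst J_move.simps) auto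

lemma at_vertex_J_move_Uncolored:
  "at_vertex J_move (Node Uncolored ts) T \<longleftrightarrow>
     (\<exists>us. (block_move Uncolored (Node Uncolored ts) (Node Uncolored us) \<or>
            children_step J_move ts us) \<and> T = Node Uncolored us)"
proof -
  have "block_move Uncolored (Node Uncolored ts) T \<Longrightarrow> \<exists>us. T = Node Uncolored us"
    unfolding block_move_iff by metis
  then show ?thesis unfolding at_vertex_Node J_move_Uncolored by metis
qed

text \<open>Without colored vertices only operation (a) can be performed.\<close>

lemma J_move_stable_dec:
  "stable_dec Uncolored T \<Longrightarrow> at_vertex J_move T T' \<longleftrightarrow> at_vertex (block_move Uncolored) T T'"
proof (induction T arbitrary: T')
  case (Node a ts)
  then have [simp]: "a = Uncolored" by simp
  \<comment> \<open>The identity map is inserted in order to reuse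
    \<open>children_step_map\<close>.\<close>
  have "children_step J_move (map (\<lambda>t. t) ts) us \<longleftrightarrow>
      (\<exists>us'. children_step (block_move Uncolored) ts us' \<and> us = map (\<lambda>t. t) us')" for us
    by (rule children_step_map) (use Node in auto)
  then have "children_step J_move ts us \<longleftrightarrow> children_step (block_move Uncolored) ts us" for us
    by simp
  then show ?case
    by (simp add: at_vertex_J_move_Uncolored at_vertex_block_move)
qed

lemma painted_move:
  "at_vertex J_move T T' \<Longrightarrow> painted T \<Longrightarrow> painted T'"
proof (induction T arbitrary: T' rule: painted.induct)
  case (1 ts)
  obtain us where us: "block_move Uncolored (Node Uncolored ts) (Node Uncolored us) \<or>
      children_step J_move ts us" "T' = Node Uncolored us"
    using 1(2) unfolding at_vertex_J_move_Uncolored by metis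
  from us(1) show ?case
  proof
    assume "block_move Uncolored (Node Uncolored ts) (Node Uncolored us)"
    then show ?thesis using 1(3) us(2) by (elim block_move_NodeE) auto
  next
    assume step: "children_step J_move ts us"
    have "\<forall>t\<in>set us. painted t"
      using step by (rule children_step_all) (use 1 in auto)
    then show ?thesis using 1(3) us(2) children_step_length[OF step] by auto
  qed
next
  case (2 ts)
  then have ts: "ts \<noteq> []" "\<forall>t\<in>set ts. stable_dec Uncolored t" by auto
  from 2(1) show ?case
    unfolding at_vertex_Node J_move_Colored
  proof (elim disjE exE conjE)
    fix us assume T': "T' = Node Colored us" and step: "children_step J_move ts us"
    have "\<forall>t\<in>set us. stable_dec Uncolored t"
      using step ts(2)
      by (rule children_step_all) (use ts(2) J_move_stable_dec stable_dec_move in metis)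
    then show ?thesis using ts(1) T' children_step_length[OF step] by auto
  qed (use ts in auto)
qed

lemma J_move_increasing:
  "J_move T T' \<Longrightarrow> length (subtrees T) < length (subtrees T')"
proof (induction rule: J_move.induct)
  case (split blocks)
  \<comment> \<open>Every block gains one vertex, its new colored root, while the old root is kept
    and only loses its color.\<close>
  have "length (concat (map subtrees (map (Node Colored) bs))) =
      length bs + length (concat (map subtrees (concat bs)))" for bs
    by (induction bs) (simp_all add: subtrees_Node)
  then show ?case using split by (auto simp: subtrees_Node)
qed (simp_all add: subtrees_Node)

section \<open>Moves at a component vertex with two seams, one of them empty\<close>

lemma map_eq_concat:
  "map f ts = concat bs \<longleftrightarrow> (\<exists>cs. ts = concat cs \<and> bs = map (map f) cs)"
proof (induction bs arbitrary: ts)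
  case Nil
  show ?case by auto
next
  case (Cons b bs)
  show ?case
  proof
    assume "map f ts = concat (b # bs)"
    then obtain us vs where *: "ts = us @ vs" "b = map f us" "map f vs = concat bs"
      unfolding concat.simps by (metis map_eq_append_conv)
    then obtain cs where "vs = concat cs" "bs = map (map f) cs" using Cons.IH by metis
    with * show "\<exists>cs. ts = concat cs \<and> b # bs = map (map f) cs"
      by (intro exI[of _ "us # cs"]) simp
  next
    assume "\<exists>cs. ts = concat cs \<and> b # bs = map (map f) cs"
    then show "map f ts = concat (b # bs)" by (metis map_concat)
  qed
qed

lemma double_eq_append:
  "[x, y] = us @ z # vs \<longleftrightarrow> us = [] \<and> z = x \<and> vs = [y] \<or> us = [x] \<and> z = y \<and> vs = []"
  by (auto simp: Cons_eq_append_conv)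

text \<open>Since \<alpha> has two incoming neighbors, the strict bound is vacuous and the whole
  sequence may be chosen as block, as in operation (b).\<close>

lemma W_move1_seams:
  assumes i: "i < 2" and a: "kind a = Comp"
  shows "W_move1 (Node a (seams i ts)) B \<longleftrightarrow>
    (\<exists>us block ws. ts = us @ block @ ws \<and> 2 \<le> length block \<and>
       B = Node a (seams i (us @ Node (BVertex Comp (Some Dashed) [i])
                                  [Node (BVertex Seam (Some Solid) [i]) block] # ws)))"
    (is "?L \<longleftrightarrow> ?R")
proof
  assume ?L
  then show ?R
  proof cases
    case (1 block xs b us ws ys)
    \<comment> \<open>This excludes the empty seam as the place of the move.\<close>
    have "block \<noteq> []" using 1 by auto
    moreover have "seams i ts = xs @ Node b (us @ block @ ws) # ys" using 1 by simp
    ultimately show ?thesis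
      using i 1
      by (intro exI[of _ us] exI[of _ block] exI[of _ ws])
        (auto simp: seams_def double_eq_append split: if_splits)
  qed
next
  assume ?R
  then obtain us block ws where *: "ts = us @ block @ ws" "2 \<le> length block"
    "B = Node a (seams i (us @ Node (BVertex Comp (Some Dashed) [i])
                                  [Node (BVertex Seam (Some Solid) [i]) block] # ws))"
    by metis
  consider "i = 0" | "i = 1" using i by linarith
  then show ?L
  proof cases
    case 1
    then show ?thesis
      using W_move1.intros[OF a *(2), where xs = "[]" and b = "BVertex Seam (Some Solid) [0]"
          and us = us and ws = ws and ys = "[Node (BVertex Seam (Some Solid) [1]) []]"] *
      by (simp add: seams_def)
  next
    case 2
    then show ?thesis
      using W_move1.intros[OF a *(2), where b = "BVertex Seam (Some Solid) [1]"
          and us = us and ws = ws and xs = "[Node (BVertex Seam (Some Solid) [0]) []]" and ys = "[]"] *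
      by (simp add: seams_def)
  qed
qed

text \<open>In the matrix of blocks of a type 3 move at two seams, one of which has no incoming
  edges, only the column of the other seam is nonempty.\<close>

lemma W_move3_seams:
  assumes i: "i < 2" and a: "kind a = Comp"
  shows "W_move3 (Node a (seams i ts)) B \<longleftrightarrow>
    (\<exists>blocks. ts = concat blocks \<and> 2 \<le> length blocks \<and> (\<forall>block\<in>set blocks. block \<noteq> []) \<and>
       B = Node a [Node (BVertex Seam (Some Solid) (coh a))
             (map (\<lambda>block. Node (BVertex Comp (Some Dashed) (coh a)) (seams i block)) blocks)])"
    (is "?L \<longleftrightarrow> ?R")
proof
  assume ?L
  then obtain C where C: "2 \<le> length C"
     "\<forall>c\<in>set C. length c = length (seams i ts) \<and> (\<exists>block\<in>set c. block \<noteq> [])"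
     "\<forall>j<length (seams i ts). concat (map (\<lambda>c. c ! j) C) = inc (seams i ts ! j)"
     and B: "B = Node a [Node (BVertex Seam (Some Solid) (coh a))
       (map (\<lambda>c. Node (BVertex Comp (Some Dashed) (coh a))
          (map2 (\<lambda>\<beta> block. Node (BVertex Seam (Some Solid) (tcoh \<beta>)) block) (seams i ts) c)) C)]"
    unfolding W_move3_iff by metis
  have l: "length (seams i ts) = 2" by (simp add: seams_def)
  \<comment> \<open>For \<open>i < 2\<close> the term \<open>1 - i\<close> is the index of the other
    seam, the empty one.\<close>
  have "concat (map (\<lambda>c. c ! i) C) = inc (seams i ts ! i)"
      "concat (map (\<lambda>c. c ! (1 - i)) C) = inc (seams i ts ! (1 - i))"
    using C(3) i l by auto
  moreover have "i = 0 \<or> i = 1" using i by linarith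
  ultimately have col: "concat (map (\<lambda>c. c ! i) C) = ts" "concat (map (\<lambda>c. c ! (1 - i)) C) = []"
    by (auto simp: seams_def)
  have c: "c = (if i = 0 then [c ! i, []] else [[], c ! i])" "c ! i \<noteq> []" if "c \<in> set C" for c
  proof -
    have "length c = 2" "\<exists>block\<in>set c. block \<noteq> []" using C(2) l that by simp_all
    then obtain x y where "c = [x, y]" "x \<noteq> [] \<or> y \<noteq> []"
      by (auto simp: length_Suc_conv numeral_2_eq_2)
    moreover have "c ! (1 - i) = []" using col(2) that by simp
    ultimately show "c = (if i = 0 then [c ! i, []] else [[], c ! i])" "c ! i \<noteq> []"
      using \<open>i = 0 \<or> i = 1\<close> by auto
  qed
  have "map2 (\<lambda>\<beta> block. Node (BVertex Seam (Some Solid) (tcoh \<beta>)) block) (seams i ts) c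
      = seams i (c ! i)" if "c \<in> set C" for c
    by (subst c(1)[OF that]) (use i in \<open>auto simp: seams_def\<close>)
  then have "B = Node a [Node (BVertex Seam (Some Solid) (coh a))
       (map (\<lambda>block. Node (BVertex Comp (Some Dashed) (coh a)) (seams i block))
          (map (\<lambda>c. c ! i) C))]"
    using B by simp
  then show ?R
    using col(1) C(1) c(2) by (intro exI[of _ "map (\<lambda>c. c ! i) C"]) auto
next
  assume ?R
  then obtain blocks where *: "ts = concat blocks" "2 \<le> length blocks"
      "\<forall>block\<in>set blocks. block \<noteq> []"
    and B: "B = Node a [Node (BVertex Seam (Some Solid) (coh a))
             (map (\<lambda>block. Node (BVertex Comp (Some Dashed) (coh a)) (seams i block)) blocks)]"
    by metis
  \<comment> \<open>Each block is padded to a row of the matrix by an empty block at the other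
    seam.\<close>
  let ?C = "map (\<lambda>block. if i = 0 then [block, []] else [[], block]) blocks"
  have i': "i = 0 \<or> i = 1" using i by linarith
  have e: "concat (map (\<lambda>b. []) bs) = []" for bs :: "bvertex rrt list list"
    by (induction bs) auto
  have "\<forall>j<length (seams i ts). concat (map (\<lambda>c. c ! j) ?C) = inc (seams i ts ! j)"
    using i' *(1) by (auto simp: seams_def o_def less_Suc_eq numeral_2_eq_2 e)
  moreover have "map (\<lambda>c. Node (BVertex Comp (Some Dashed) (coh a))
          (map2 (\<lambda>\<beta> block. Node (BVertex Seam (Some Solid) (tcoh \<beta>)) block) (seams i ts) c)) ?C
      = map (\<lambda>block. Node (BVertex Comp (Some Dashed) (coh a)) (seams i block)) blocks"
    using i' by (auto simp: seams_def)
  moreover have "\<forall>c\<in>set ?C. length c = length (seams i ts) \<and> (\<exists>block\<in>set c. block \<noteq> [])"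
    using *(3) by (auto simp: seams_def)
  moreover have "2 \<le> length ?C" "2 \<le> length (seams i ts)"
    using *(2) by (auto simp: seams_def)
  ultimately show ?L
    unfolding W_move3_iff B using a by (intro conjI exI[of _ ?C]) simp_all
qed

lemma bubble_move_seams:
  assumes "i < 2" and "kind a = Comp"
  shows "at_vertex bubble_move (Node a (seams i ts)) B \<longleftrightarrow>
    (\<exists>us block ws. ts = us @ block @ ws \<and> 2 \<le> length block \<and>
       B = Node a (seams i (us @ Node (BVertex Comp (Some Dashed) [i])
                                  [Node (BVertex Seam (Some Solid) [i]) block] # ws))) \<or>
    (\<exists>blocks. ts = concat blocks \<and> 2 \<le> length blocks \<and> (\<forall>block\<in>set blocks. block \<noteq> []) \<and>
       B = Node a [Node (BVertex Seam (Some Solid) (coh a))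
             (map (\<lambda>block. Node (BVertex Comp (Some Dashed) (coh a)) (seams i block)) blocks)]) \<or>
    (\<exists>us. children_step bubble_move ts us \<and> B = Node a (seams i us))"
proof -
  have "i = 0 \<or> i = 1" using assms(1) by linarith
  \<comment> \<open>A seam is not itself the place of a move, and the empty seam has no children, so
    the step happens among the children of the seam with index \<open>i\<close>.\<close>
  then have "children_step bubble_move (seams i ts) bs \<longleftrightarrow>
      (\<exists>us. children_step bubble_move ts us \<and> bs = seams i us)" for bs
    by (auto simp: seams_def bubble_move_Seam)
  then have "(\<exists>bs. B = Node a bs \<and> children_step bubble_move (seams i ts) bs) \<longleftrightarrow>
      (\<exists>us. children_step bubble_move ts us \<and> B = Node a (seams i us))"
    by metis
  then show ?thesis
    unfolding at_vertex_Node[of _ a] bubble_move_def[of "Node a (seams i ts)"]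
      W_move1_seams[OF assms] W_move3_seams[OF assms] by (simp only: disj_assoc)
qed

text \<open>At a colored root, the three alternatives of \<open>bubble_move_seams\<close> are
  operation (b), operation (c) and a move in one of the children; an uncolored root is covered by
  \<open>bubble_move_map\<close>.\<close>

lemma bubble_move_enc_painted:
  assumes i: "i < 2"
  shows "painted T \<Longrightarrow> at_vertex bubble_move (enc_painted i s T) B \<longleftrightarrow>
     (\<exists>T'. at_vertex J_move T T' \<and> B = enc_painted i s T')"
proof (induction T arbitrary: s B rule: painted.induct)
  case (1 ts)
  have "at_vertex bubble_move (enc_painted i s (Node Uncolored ts)) B \<longleftrightarrow>
    (\<exists>us. (block_move Uncolored (Node Uncolored ts) (Node Uncolored us) \<or>
          children_step J_move ts us) \<and>
          B = enc_painted i s (Node Uncolored us))"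
    unfolding enc_painted.simps by (rule bubble_move_map) (use 1 in auto)
  then show ?case
    unfolding at_vertex_J_move_Uncolored by metis
next
  case (2 ts)
  let ?f = "enc (Some Dashed) [i]"
  let ?a = "BVertex Comp s []"
  have ts: "\<forall>t\<in>set ts. stable_dec Uncolored t" using 2 by simp
  define F where "F us block ws = us @ Node (BVertex Comp (Some Dashed) [i])
      [Node (BVertex Seam (Some Solid) [i]) block] # ws" for us block ws
  define G where "G blocks = Node ?a [Node (BVertex Seam (Some Solid) [])
      (map (\<lambda>block. Node (BVertex Comp (Some Dashed) []) (seams i block)) blocks)]" for blocks
  \<comment> \<open>The bound ensures that the new uncolored vertex is encoded as an interior vertex
    and not as a mark.\<close>
  have F: "Node ?a (seams i (F (map ?f us) (map ?f block) (map ?f ws))) =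
      enc_painted i s (Node Colored (us @ Node Uncolored block # ws))"
    if "2 \<le> length block" for us block ws
    using that by (auto simp: F_def)
  have G: "G (map (map ?f) blocks) = enc_painted i s (Node Uncolored (map (Node Colored) blocks))"
    for blocks by (simp add: G_def)
  have ch: "children_step bubble_move (map ?f ts) bs \<longleftrightarrow>
      (\<exists>us. children_step J_move ts us \<and> bs = map ?f us)" for bs
    by (rule children_step_map) (use ts bubble_move_enc J_move_stable_dec in metis)
  have "at_vertex bubble_move (enc_painted i s (Node Colored ts)) B \<longleftrightarrow>
    (\<exists>us block ws. map ?f ts = us @ block @ ws \<and> 2 \<le> length block \<and>
       B = Node ?a (seams i (F us block ws))) \<or>
    (\<exists>blocks. map ?f ts = concat blocks \<and> 2 \<le> length blocks \<and>
       (\<forall>block\<in>set blocks. block \<noteq> []) \<and> B = G blocks) \<or>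
    (\<exists>bs. children_step bubble_move (map ?f ts) bs \<and> B = Node ?a (seams i bs))"
    unfolding enc_painted.simps by (subst bubble_move_seams[OF i]) (simp_all add: F_def G_def)
  also have "(\<exists>us block ws. map ?f ts = us @ block @ ws \<and> 2 \<le> length block \<and>
       B = Node ?a (seams i (F us block ws))) \<longleftrightarrow>
     (\<exists>us block ws. ts = us @ block @ ws \<and> 2 \<le> length block \<and>
        B = enc_painted i s (Node Colored (us @ Node Uncolored block # ws)))"
    unfolding ex_map_append length_map using F by metis
  also have "(\<exists>blocks. map ?f ts = concat blocks \<and> 2 \<le> length blocks \<and>
       (\<forall>block\<in>set blocks. block \<noteq> []) \<and> B = G blocks) \<longleftrightarrow>
     (\<exists>blocks. ts = concat blocks \<and> 2 \<le> length blocks \<and> (\<forall>block\<in>set blocks. block \<noteq> []) \<and>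
        B = enc_painted i s (Node Uncolored (map (Node Colored) blocks)))"
  proof -
    have "(\<exists>blocks. map ?f ts = concat blocks \<and> P blocks) \<longleftrightarrow>
        (\<exists>cs. ts = concat cs \<and> P (map (map ?f) cs))" for P
      unfolding map_eq_concat by blast
    then show ?thesis by (simp add: G del: enc_painted.simps)
  qed
  also have "(\<exists>bs. children_step bubble_move (map ?f ts) bs \<and> B = Node ?a (seams i bs)) \<longleftrightarrow>
      (\<exists>us. children_step J_move ts us \<and> B = enc_painted i s (Node Colored us))"
    unfolding ch enc_painted.simps by metis
  finally show ?case
    unfolding at_vertex_Node J_move_Colored by blast
qed


section \<open>Classification of the stable tree-pairs\<close>

lemma all_subtrees_Node:
  "(\<forall>t\<in>set (subtrees (Node a ts)). P t) \<longleftrightarrow>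
     P (Node a ts) \<and> (\<forall>u\<in>set ts. \<forall>t\<in>set (subtrees u). P t)"
  by (auto simp: subtrees_Node)

text \<open>All the conditions on a tree-pair that involve a vertex and its incoming neighbors only,
  gathered at that vertex so that an induction over the bubble tree can use them together. What
  remains concerns the root, the seam tree and the mark counts.\<close>

definition vertex_ok :: "unit rrt \<Rightarrow> bvertex rrt \<Rightarrow> bool" where
  "vertex_ok S t \<longleftrightarrow>
     (\<forall>s\<in>set (inc t). tout s \<noteq> None) \<and>
     (case tkind t of
        Comp \<Rightarrow> (\<exists>s\<in>set (inc t). tout s = Some Solid) \<and>
                (\<forall>s\<in>set (inc t). tout s \<noteq> Some Dashed) \<and>
                (tout t = Some Dashed \<or> tout t = None)
      | Seam \<Rightarrow> (\<forall>s\<in>set (inc t). tout s \<noteq> Some Solid) \<and> tout t = Some Solid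
      | Mark \<Rightarrow> inc t = [] \<and> (tout t = Some Dashed \<or> tout t = None)) \<and>
     (tkind t = Comp \<longrightarrow>
        (\<forall>s. inc t = [s] \<longrightarrow> 2 \<le> length (inc s)) \<and>
        (2 \<le> length (inc t) \<longrightarrow> (\<exists>s\<in>set (inc t). 1 \<le> length (inc s)))) \<and>
     tcoh t \<in> set (verts S) \<and>
     (\<forall>s\<in>set (inc t).
        (tcoh s \<in> set (in_verts S (tcoh t)) \<or> tcoh s = tcoh t) \<and>
        (tout s = Some Dashed \<longrightarrow> tcoh s = tcoh t) \<and>
        (tout s = Some Solid \<and> tkind t = Comp \<and> length (inc t) = 1 \<longrightarrow> tcoh s = tcoh t)) \<and>
     (tkind t = Comp \<and> 2 \<le> length (inc t) \<longrightarrow> map tcoh (inc t) = in_verts S (tcoh t)) \<and>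
     (tkind t = Mark \<longrightarrow> tcoh t \<in> set (leaves S))"

definition all_ok :: "unit rrt \<Rightarrow> bvertex rrt \<Rightarrow> bool" where
  "all_ok S B \<longleftrightarrow> (\<forall>t\<in>set (subtrees B). vertex_ok S t)"

lemma all_ok_Node: "all_ok S (Node a ts) \<longleftrightarrow> vertex_ok S (Node a ts) \<and> (\<forall>t\<in>set ts. all_ok S t)"
  unfolding all_ok_def all_subtrees_Node by (rule refl)

definition marks :: "nat list \<Rightarrow> bvertex rrt \<Rightarrow> nat" where
  "marks c B = length (filter (\<lambda>t. tkind t = Mark \<and> tcoh t = c) (subtrees B))"

lemma marks_Node:
  "marks c (Node a ts) = (if kind a = Mark \<and> coh a = c then 1 else 0) + (\<Sum>t\<leftarrow>ts. marks c t)"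
  by (simp add: marks_def subtrees_Node filter_concat length_concat o_def)

lemma W_tree_iff:
  "(B, S) \<in> W_tree n \<longleftrightarrow>
     S \<in> K_tree (length n) \<and> tout B = None \<and> tcoh B = [] \<and> all_ok S B \<and>
     (\<forall>i<length n. marks (leaves S ! i) B = n ! i)"
  unfolding W_tree_def bubble_tree_def stable_bubble_def coherent_def all_ok_def vertex_ok_def
    marks_def by auto

lemma leaves_subset_verts: "set (leaves T) \<subseteq> set (verts T)"
  by (auto simp: leaves_def)

lemma in_verts_leaf: "c \<in> set (leaves T) \<Longrightarrow> in_verts T c = []"
  by (simp add: leaves_def)

lemma vertex_ok_Mark:
  "kind a = Mark \<Longrightarrow> vertex_ok S (Node a ts) \<longleftrightarrow>
     ts = [] \<and> (out a = Some Dashed \<or> out a = None) \<and> coh a \<in> set (leaves S)"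
  unfolding vertex_ok_def using leaves_subset_verts by auto

lemma style_eq_Dashed: "x \<noteq> None \<and> x \<noteq> Some Solid \<longleftrightarrow> x = Some Dashed"
  by (cases x; cases "the x") auto

lemma style_eq_Solid: "x \<noteq> None \<and> x \<noteq> Some Dashed \<longleftrightarrow> x = Some Solid"
  by (cases x; cases "the x") auto

lemma vertex_ok_Seam:
  assumes "kind a = Seam"
  shows "vertex_ok S (Node a ts) \<longleftrightarrow>
     out a = Some Solid \<and> coh a \<in> set (verts S) \<and>
     (\<forall>s\<in>set ts. tout s = Some Dashed \<and> tcoh s = coh a)"
proof -
  have "(\<forall>s\<in>set ts. tout s \<noteq> None) \<and> (\<forall>s\<in>set ts. tout s \<noteq> Some Solid) \<longleftrightarrow>
      (\<forall>s\<in>set ts. tout s = Some Dashed)"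
    using style_eq_Dashed by metis
  then show ?thesis
    unfolding vertex_ok_def using assms by auto
qed

text \<open>The required solid edge excludes an empty sequence, which leaves the contracted case and
  the case of a bijection onto the neighbors of the image.\<close>

lemma vertex_ok_Comp:
  assumes "kind a = Comp"
  shows "vertex_ok S (Node a ts) \<longleftrightarrow>
     (out a = Some Dashed \<or> out a = None) \<and> coh a \<in> set (verts S) \<and>
     (\<forall>s\<in>set ts. tout s = Some Solid) \<and>
     ((\<exists>s. ts = [s] \<and> tcoh s = coh a \<and> 2 \<le> length (inc s)) \<or>
      2 \<le> length ts \<and> map tcoh ts = in_verts S (coh a) \<and> (\<exists>s\<in>set ts. inc s \<noteq> []))"
proof -
  have *: "(\<forall>s\<in>set ts. tout s \<noteq> None) \<and> (\<forall>s\<in>set ts. tout s \<noteq> Some Dashed) \<longleftrightarrow>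
      (\<forall>s\<in>set ts. tout s = Some Solid)"
    using style_eq_Solid by metis
  consider "ts = []" | s where "ts = [s]" | "2 \<le> length ts"
    by (cases ts rule: remdups_adj.cases) auto
  then show ?thesis
  proof cases
    case 1
    then show ?thesis using assms by (simp add: vertex_ok_def)
  next
    case 2
    then show ?thesis using assms * by (auto simp: vertex_ok_def)
  next
    case 3
    \<comment> \<open>The bijection already supplies the condition that edges map to edges.\<close>
    have sub: "\<forall>s\<in>set ts. tcoh s \<in> set (in_verts S (coh a))"
      if "map tcoh ts = in_verts S (coh a)"
      unfolding that[symmetric] by simp
    have "ts \<noteq> []" "length ts \<noteq> 1" using 3 by auto
    then obtain s where "s \<in> set ts" by (cases ts) auto
    with 3 sub assms * \<open>length ts \<noteq> 1\<close> show ?thesis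
      by (auto simp: vertex_ok_def Suc_le_eq)
  qed
qed

text \<open>Only seams have a solid outgoing edge, so the edge styles that a vertex prescribes fix
  which of its children are seams; at the root, \<open>None\<close> excludes a seam.\<close>

lemma all_ok_Seam_iff: "all_ok S b \<Longrightarrow> tkind b = Seam \<longleftrightarrow> tout b = Some Solid"
proof (cases b)
  case (Node a ts)
  then show "all_ok S b \<Longrightarrow> tkind b = Seam \<longleftrightarrow> tout b = Some Solid"
    by (cases "kind a") (auto simp: all_ok_Node vertex_ok_Mark vertex_ok_Comp vertex_ok_Seam)
qed

lemma ex_map_list:
  "\<forall>x\<in>set xs. \<exists>y. P y \<and> x = f y \<Longrightarrow> \<exists>ys. (\<forall>y\<in>set ys. P y) \<and> xs = map f ys"
proof (induction xs)
  case (Cons x xs)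
  then obtain y ys where "P y" "x = f y" "\<forall>y\<in>set ys. P y" "xs = map f ys" by auto
  then show ?case by (intro exI[of _ "y # ys"]) simp
qed simp

lemma dec_enc:
  "tout (enc s c T) = s" "tcoh (enc s c T) = c"
  by (cases T; simp)+

lemma all_ok_enc:
  assumes c: "c \<in> set (leaves S)"
  shows "s = Some Dashed \<or> s = None \<Longrightarrow> stable_dec d T \<Longrightarrow> all_ok S (enc s c T)"
proof (induction T arbitrary: s)
  case (Node a ts)
  show ?case
    using Node c leaves_subset_verts[of S]
    by (auto simp: all_ok_Node vertex_ok_Mark vertex_ok_Comp vertex_ok_Seam dec_enc)
qed

text \<open>The induction visits seams as well, and a seam alone encodes no tree but a sequence of
  trees; hence the two halves.\<close>

lemma all_ok_leaf:
  assumes c: "c \<in> set (leaves S)"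
  shows "all_ok S B \<Longrightarrow> tcoh B = c \<Longrightarrow>
    (tkind B \<noteq> Seam \<longrightarrow> (\<exists>T. stable_dec d T \<and> B = enc (tout B) c T)) \<and>
    (tkind B = Seam \<longrightarrow> (\<exists>ts. (\<forall>t\<in>set ts. stable_dec d t) \<and>
       B = Node (BVertex Seam (Some Solid) c) (map (enc (Some Dashed) c) ts)))"
proof (induction B)
  case (Node a bs)
  obtain k s where a: "a = BVertex k s c" using Node.prems(2) by (cases a) auto
  have ok: "vertex_ok S (Node a bs)" "\<forall>b\<in>set bs. all_ok S b"
    using Node.prems(1) by (auto simp: all_ok_Node)
  show ?case
  proof (cases k)
    case Mark
    then have "bs = []" using ok(1) by (simp add: a vertex_ok_Mark)
    then show ?thesis using Mark by (auto simp: a intro!: exI[of _ "Node d []"])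
  next
    case Seam
    then have s: "s = Some Solid" and bs: "\<forall>b\<in>set bs. tout b = Some Dashed \<and> tcoh b = c"
      using ok(1) by (auto simp: a vertex_ok_Seam)
    have "\<exists>T. stable_dec d T \<and> b = enc (Some Dashed) c T" if b: "b \<in> set bs" for b
    proof -
      have "tkind b \<noteq> Seam"
        using b bs ok(2) all_ok_Seam_iff[of S b] by simp
      then show ?thesis using Node.IH[OF b] b bs ok(2) by auto
    qed
    then have "\<exists>ts. (\<forall>t\<in>set ts. stable_dec d t) \<and> bs = map (enc (Some Dashed) c) ts"
      by (intro ex_map_list) blast
    then show ?thesis using Seam s by (auto simp: a)
  next
    case Comp
    \<comment> \<open>A bijection from two or more neighbors onto an empty sequence is impossible,
      so the vertex has a single seam, lying over \<open>c\<close> too.\<close>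
    have "in_verts S c = []" using c by (rule in_verts_leaf)
    then obtain b where b: "bs = [b]" "tcoh b = c" "2 \<le> length (inc b)" "tout b = Some Solid"
      using ok(1) Comp by (auto simp: a vertex_ok_Comp)
    have "tkind b = Seam"
      using b ok(2) all_ok_Seam_iff[of S b] by simp
    then obtain ts where ts: "\<forall>t\<in>set ts. stable_dec d t"
       "b = Node (BVertex Seam (Some Solid) c) (map (enc (Some Dashed) c) ts)"
      using Node.IH[of b] b ok(2) by auto
    then have "2 \<le> length ts" using b(3) by simp
    then show ?thesis
      using ts b(1) Comp by (auto simp: a intro!: exI[of _ "Node d ts"])
  qed
qed

lemma marks_enc:
  "marks c' (enc s c T) = (if c' = c then length (leaves T) else 0)"
proof (induction T arbitrary: s)
  case (Node a ts)
  then have "map (marks c') (map (enc (Some Dashed) c) ts) =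
      map (\<lambda>t. if c' = c then length (leaves t) else 0) ts"
    by simp
  then have "(\<Sum>t\<leftarrow>ts. marks c' (enc (Some Dashed) c t)) =
      (\<Sum>t\<leftarrow>ts. if c' = c then length (leaves t) else 0)"
    by (simp add: o_def cong: map_cong)
  then show ?case
    by (auto simp: marks_Node length_leaves_Node o_def simp flip: length_greater_0_conv)
qed

section \<open>Seam trees with one or two leaves, and tree-pairs of type \<open>(n)\<close>\<close>

lemma stable_iff: "stable T \<longleftrightarrow> stable_dec () T"
proof (induction T)
  case (Node a ts)
  have "stable (Node a ts) \<longleftrightarrow> (ts \<noteq> [] \<longrightarrow> 2 \<le> length ts) \<and> (\<forall>t\<in>set ts. stable t)"
    unfolding stable_def all_subtrees_Node by simp
  then show ?case using Node by auto
qed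

lemma K_tree_iff: "T \<in> K_tree n \<longleftrightarrow> stable_dec () T \<and> length (leaves T) = n"
  by (simp add: K_tree_def stable_iff)

lemma K_tree_1: "T \<in> K_tree 1 \<longleftrightarrow> T = Node () []"
proof (cases T)
  case (Node a ts)
  have "2 \<le> length ts \<Longrightarrow> (\<Sum>t\<leftarrow>ts. length (leaves t)) \<noteq> 1"
    using length_le_sum_leaves[of ts] by linarith
  then show ?thesis
    by (auto simp: K_tree_iff Node length_leaves_Node)
qed

abbreviation cherry :: "unit rrt" where
  "cherry \<equiv> Node () [Node () [], Node () []]"

lemma K_tree_2: "T \<in> K_tree 2 \<longleftrightarrow> T = cherry"
proof
  assume T: "T \<in> K_tree 2"
  obtain ts where ts: "T = Node () ts" by (cases T) auto
  have nonempty: "ts \<noteq> []" using T by (auto simp: ts K_tree_iff length_leaves_Node)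
  then have l: "2 \<le> length ts" "(\<Sum>t\<leftarrow>ts. length (leaves t)) = 2" "\<forall>t\<in>set ts. stable_dec () t"
    using T by (auto simp: ts K_tree_iff length_leaves_Node)
  \<comment> \<open>Stability gives at least two children, and two leaves allow at most two.\<close>
  then have "length ts = 2" using length_le_sum_leaves[of ts] by linarith
  then obtain t u where tu: "ts = [t, u]" by (auto simp: length_Suc_conv numeral_2_eq_2)
  have "1 \<le> length (leaves t)" "1 \<le> length (leaves u)"
    using leaves_nonempty[of t] leaves_nonempty[of u] by (simp_all add: Suc_le_eq)
  then have "length (leaves t) = 1" "length (leaves u) = 1" using l(2) by (simp_all add: tu)
  then have "t \<in> K_tree 1" "u \<in> K_tree 1" using l(3) by (simp_all add: tu K_tree_iff)
  then show "T = cherry" by (simp only: K_tree_1 ts tu)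
next
  assume "T = cherry"
  then show "T \<in> K_tree 2" by (simp add: K_tree_iff length_leaves_Node)
qed

lemma W_tree_single:
  "W_tree [n] = (\<lambda>T. (enc None [] T, Node () [])) ` K_tree n"
proof -
  have leaves: "leaves (Node () []) = [[]]" by (simp add: leaves_Node)
  have "(B, S) \<in> W_tree [n] \<longleftrightarrow> S = Node () [] \<and> (\<exists>T\<in>K_tree n. B = enc None [] T)" for B S
  proof
    assume W: "(B, S) \<in> W_tree [n]"
    then have S: "S = Node () []" by (simp add: W_tree_iff K_tree_1[simplified])
    then have B: "tout B = None" "tcoh B = []" "all_ok (Node () []) B" "marks [] B = n"
      using W by (auto simp: W_tree_iff leaves)
    have "tkind B \<noteq> Seam"
      using B all_ok_Seam_iff by simp
    then obtain T where "stable_dec () T" "B = enc None [] T"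
      using all_ok_leaf[of "[]" "Node () []" B "()"] B leaves by auto
    with B(4) S show "S = Node () [] \<and> (\<exists>T\<in>K_tree n. B = enc None [] T)"
      by (auto simp: K_tree_iff marks_enc)
  next
    assume "S = Node () [] \<and> (\<exists>T\<in>K_tree n. B = enc None [] T)"
    then show "(B, S) \<in> W_tree [n]"
      using all_ok_enc[of "[]" "Node () []" None "()"] leaves
      by (auto simp: W_tree_iff K_tree_1[simplified] K_tree_iff[of _ n] marks_enc dec_enc)
  qed
  then show ?thesis by auto
qed


section \<open>Tree-pairs over the cherry\<close>

lemma verts_cherry: "verts cherry = [[], [0], [1]]"
  by (simp add: upt_rec)

lemma leaves_cherry: "leaves cherry = [[0], [1]]"
  by (simp add: leaves_Node upt_rec)

lemma in_verts_cherry: "in_verts cherry [] = [[0], [1]]"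
  by (simp add: in_verts_def upt_rec)

lemma dec_enc_painted:
  "tout (enc_painted i s T) = s" "tcoh (enc_painted i s T) = []"
  by (cases T rule: painted.cases; simp)+

lemma all_ok_enc_painted:
  assumes i: "i < 2"
  shows "s = Some Dashed \<or> s = None \<Longrightarrow> painted T \<Longrightarrow> all_ok cherry (enc_painted i s T)"
proof (induction T arbitrary: s rule: painted.induct)
  case (1 ts)
  then show ?case
    by (auto simp: all_ok_Node vertex_ok_Comp vertex_ok_Seam dec_enc_painted verts_cherry)
next
  case (2 ts)
  have i': "i = 0 \<or> i = 1" using i by linarith
  then have "[i] \<in> set (leaves cherry)" by (auto simp: leaves_cherry)
  then have "all_ok cherry (enc (Some Dashed) [i] t)" if "t \<in> set ts" for t
    using 2 that all_ok_enc[OF \<open>[i] \<in> _\<close>, of "Some Dashed" Uncolored t] by simp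
  then show ?case
    using 2 i'
    by (auto simp: seams_def all_ok_Node vertex_ok_Comp vertex_ok_Seam dec_enc verts_cherry
        in_verts_cherry)
qed

lemma all_ok_seam_leaf:
  assumes "all_ok S b" "tout b = Some Solid" "tcoh b = c" "c \<in> set (leaves S)"
  obtains ts where "\<forall>t\<in>set ts. stable_dec d t"
    "b = Node (BVertex Seam (Some Solid) c) (map (enc (Some Dashed) c) ts)"
proof -
  have "tkind b = Seam" using all_ok_Seam_iff[OF assms(1)] assms(2) by simp
  then have "\<exists>ts. (\<forall>t\<in>set ts. stable_dec d t) \<and>
      b = Node (BVertex Seam (Some Solid) c) (map (enc (Some Dashed) c) ts)"
    using all_ok_leaf[OF assms(4,1,3), of d] by (simp only: simp_thms)
  then show thesis by (elim exE conjE) (rule that)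
qed

lemma marks_map_enc:
  "marks c (Node (BVertex Seam s c) (map (enc (Some Dashed) c) ts)) =
     (\<Sum>t\<leftarrow>ts. length (leaves t))"
  by (simp add: marks_Node o_def marks_enc)

text \<open>Over the root of the cherry, a component with one neighbor stays over the root and
  becomes uncolored, while one with two neighbors sends them to the two leaves and becomes colored.
  As over a leaf, seams need a separate half.\<close>

lemma all_ok_root:
  assumes i: "i < 2"
  shows "all_ok cherry B \<Longrightarrow> tcoh B = [] \<Longrightarrow> marks [1 - i] B = 0 \<Longrightarrow>
    (tkind B \<noteq> Seam \<longrightarrow> (\<exists>T. painted T \<and> B = enc_painted i (tout B) T)) \<and>
    (tkind B = Seam \<longrightarrow> (\<exists>ts. (\<forall>t\<in>set ts. painted t) \<and>
       B = Node (BVertex Seam (Some Solid) []) (map (enc_painted i (Some Dashed)) ts)))"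
proof (induction B)
  case (Node a bs)
  obtain k s where a: "a = BVertex k s []" using Node.prems(2) by (cases a) auto
  have ok: "vertex_ok cherry (Node a bs)" "\<forall>b\<in>set bs. all_ok cherry b"
    using Node.prems(1) by (auto simp: all_ok_Node)
  have marks: "\<forall>b\<in>set bs. marks [1 - i] b = 0"
    using Node.prems(3) by (auto simp: marks_Node)
  show ?case
  proof (cases k)
    case Mark
    \<comment> \<open>The root of the cherry is not a leaf, so no mark lies over it.\<close>
    then show ?thesis using ok(1) by (simp add: a vertex_ok_Mark leaves_cherry)
  next
    case Seam
    then have s: "s = Some Solid" and bs: "\<forall>b\<in>set bs. tout b = Some Dashed \<and> tcoh b = []"
      using ok(1) by (auto simp: a vertex_ok_Seam)
    have "\<exists>T. painted T \<and> b = enc_painted i (Some Dashed) T" if b: "b \<in> set bs" for b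
    proof -
      have "tkind b \<noteq> Seam"
        using b bs ok(2) all_ok_Seam_iff[of cherry b] by simp
      then show ?thesis using Node.IH[OF b] b bs ok(2) marks by auto
    qed
    then have "\<exists>ts. (\<forall>t\<in>set ts. painted t) \<and> bs = map (enc_painted i (Some Dashed)) ts"
      by (intro ex_map_list) blast
    then show ?thesis using Seam s by (auto simp: a)
  next
    case Comp
    then have solid: "\<forall>b\<in>set bs. tout b = Some Solid"
      and alt: "(\<exists>b. bs = [b] \<and> tcoh b = [] \<and> 2 \<le> length (inc b)) \<or>
        map tcoh bs = [[0], [1]] \<and> (\<exists>b\<in>set bs. inc b \<noteq> [])"
      using ok(1) by (auto simp: a vertex_ok_Comp in_verts_cherry)
    from alt show ?thesis
    proof (elim disjE exE conjE)
      fix b assume b: "bs = [b]" "tcoh b = []" "2 \<le> length (inc b)"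
      have "tkind b = Seam"
        using b(1) solid ok(2) all_ok_Seam_iff[of cherry b] by simp
      then obtain ts where ts: "\<forall>t\<in>set ts. painted t"
        "b = Node (BVertex Seam (Some Solid) []) (map (enc_painted i (Some Dashed)) ts)"
        using Node.IH[of b] b ok(2) marks by auto
      then have "2 \<le> length ts" using b(3) by simp
      then show ?thesis
        using ts b(1) Comp by (auto simp: a intro!: exI[of _ "Node Uncolored ts"])
    next
      assume bs: "map tcoh bs = [[0], [1]]" "\<exists>b\<in>set bs. inc b \<noteq> []"
      then obtain x y where xy: "bs = [x, y]" "tcoh x = [0]" "tcoh y = [1]"
        by (auto simp: map_eq_Cons_conv)
      obtain ts where ts: "\<forall>t\<in>set ts. stable_dec Uncolored t"
        "x = Node (BVertex Seam (Some Solid) [0]) (map (enc (Some Dashed) [0]) ts)"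
        by (rule all_ok_seam_leaf[of cherry x "[0]" Uncolored])
          (use xy ok(2) solid in \<open>auto simp: leaves_cherry\<close>)
      obtain us where us: "\<forall>u\<in>set us. stable_dec Uncolored u"
        "y = Node (BVertex Seam (Some Solid) [1]) (map (enc (Some Dashed) [1]) us)"
        by (rule all_ok_seam_leaf[of cherry y "[1]" Uncolored])
          (use xy ok(2) solid in \<open>auto simp: leaves_cherry\<close>)
      have nil: "ws = []" if "(\<Sum>w\<leftarrow>ws. length (leaves w)) = 0" for ws :: "color rrt list"
        using length_le_sum_leaves[of ws] that by simp
      consider "i = 0" | "i = 1" using i by linarith
      then show ?thesis
      proof cases
        case 1
        then have "marks [1] y = 0" using marks xy(1) by simp
        then have "us = []" unfolding us(2) marks_map_enc by (rule nil)
        \<comment> \<open>Stability provides a nonempty seam, which can only be \<open>x\<close>;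
          thus \<open>ts\<close> is nonempty, as \<open>painted\<close> demands of a colored
          vertex.\<close>
        then show ?thesis
          using ts us(2) xy bs(2) Comp 1
          by (auto simp: a seams_def intro!: exI[of _ "Node Colored ts"])
      next
        case 2
        then have "marks [0] x = 0" using marks xy(1) by simp
        then have "ts = []" unfolding ts(2) marks_map_enc by (rule nil)
        then show ?thesis
          using us ts(2) xy bs(2) Comp 2
          by (auto simp: a seams_def intro!: exI[of _ "Node Colored us"])
      qed
    qed
  qed
qed

lemma marks_enc_painted:
  assumes "i < 2"
  shows "painted T \<Longrightarrow> marks [i] (enc_painted i s T) = length (leaves T)"
    and "painted T \<Longrightarrow> marks [1 - i] (enc_painted i s T) = 0"
proof (induction T arbitrary: s rule: painted.induct)
  case (1 ts)
  {
    case 1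
    have "(\<Sum>t\<leftarrow>ts. marks [i] (enc_painted i (Some Dashed) t)) = (\<Sum>t\<leftarrow>ts. length (leaves t))"
      using 1 "1.IH"(1) by (intro arg_cong[of _ _ sum_list] map_cong) auto
    then show ?case using 1 by (auto simp: marks_Node length_leaves_Node o_def)
  next
    case 2
    then show ?case using "1.IH"(2) by (auto simp: marks_Node o_def)
  }
next
  case (2 ts)
  have "i = 0 \<or> i = 1" using assms by linarith
  moreover {
    case 1
    then show ?case using calculation
      by (auto simp: marks_Node seams_def o_def marks_enc length_leaves_Node)
  next
    case 2
    then show ?case using calculation
      by (auto simp: marks_Node seams_def o_def marks_enc)
  }
qed

text \<open>The list update covers both types at once: \<open>i = 0\<close> is \<open>(n, 0)\<close>
  and \<open>i = 1\<close> is \<open>(0, n)\<close>.\<close>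

lemma W_tree_pair:
  assumes i: "i < 2"
  shows "W_tree ([0, 0][i := n]) =
    (\<lambda>T. (enc_painted i None T, cherry)) ` {T. painted T \<and> length (leaves T) = n}"
proof -
  have i': "i = 0 \<or> i = 1" using i by linarith
  have length: "length ([0, 0][i := n]) = 2" by (simp only: length_list_update) simp
  have marks_iff: "(\<forall>j<2. marks (leaves cherry ! j) B = [0, 0][i := n] ! j) \<longleftrightarrow>
      marks [i] B = n \<and> marks [1 - i] B = 0" for B
    using i' by (auto simp: leaves_cherry All_less_Suc numeral_2_eq_2)
  have "(B, S) \<in> W_tree ([0, 0][i := n]) \<longleftrightarrow>
      S = cherry \<and> tout B = None \<and> tcoh B = [] \<and> all_ok cherry B \<and>
      marks [i] B = n \<and> marks [1 - i] B = 0" for B S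
    unfolding W_tree_iff length K_tree_2 using marks_iff by metis
  moreover have "tout B = None \<and> tcoh B = [] \<and> all_ok cherry B \<and>
      marks [i] B = n \<and> marks [1 - i] B = 0 \<longleftrightarrow>
      (\<exists>T. painted T \<and> length (leaves T) = n \<and> B = enc_painted i None T)" for B
  proof
    assume B: "tout B = None \<and> tcoh B = [] \<and> all_ok cherry B \<and>
      marks [i] B = n \<and> marks [1 - i] B = 0"
    then have "tkind B \<noteq> Seam" using all_ok_Seam_iff[of cherry B] by simp
    then obtain T where "painted T" "B = enc_painted i None T"
      using all_ok_root[OF i, of B] B by auto
    then show "\<exists>T. painted T \<and> length (leaves T) = n \<and> B = enc_painted i None T"
      using B marks_enc_painted[OF i] by auto
  next
    assume "\<exists>T. painted T \<and> length (leaves T) = n \<and> B = enc_painted i None T"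
    then show "tout B = None \<and> tcoh B = [] \<and> all_ok cherry B \<and>
      marks [i] B = n \<and> marks [1 - i] B = 0"
      using marks_enc_painted[OF i] all_ok_enc_painted[OF i] dec_enc_painted by auto
  qed
  ultimately show ?thesis by auto
qed

section \<open>The path condition on colors in recursive form\<close>

lemma all_leaves_Node:
  "ts \<noteq> [] \<Longrightarrow> (\<forall>p\<in>set (leaves (Node a ts)). P p) \<longleftrightarrow>
     (\<forall>i<length ts. \<forall>p\<in>set (leaves (ts ! i)). P (i # p))"
  by (auto simp: leaves_Node_Cons)

text \<open>Every vertex lies on the path from some leaf to the root, because the subtree at the
  vertex has a leaf.\<close>

lemma avoids_dec_iff:
  "(\<forall>p\<in>set (leaves T). \<forall>q. prefix q p \<longrightarrow> dec (subtree_at T q) \<noteq> d) \<longleftrightarrow>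
     (\<forall>t\<in>set (subtrees T). dec t \<noteq> d)"
proof (induction T)
  case (Node a ts)
  show ?case
  proof (cases "ts = []")
    case True
    then show ?thesis by (simp add: leaves_Node subtrees_Node)
  next
    case False
    have "(\<forall>q. prefix q (i # p) \<longrightarrow> dec (subtree_at (Node a ts) q) \<noteq> d) \<longleftrightarrow>
        a \<noteq> d \<and> (\<forall>q. prefix q p \<longrightarrow> dec (subtree_at (ts ! i) q) \<noteq> d)" for i p
      by (auto simp: prefix_Cons)
    then have "(\<forall>p\<in>set (leaves (Node a ts)). \<forall>q. prefix q p \<longrightarrow> dec (subtree_at (Node a ts) q) \<noteq> d)
        \<longleftrightarrow> (\<forall>i<length ts. \<forall>p\<in>set (leaves (ts ! i)).
              a \<noteq> d \<and> (\<forall>q. prefix q p \<longrightarrow> dec (subtree_at (ts ! i) q) \<noteq> d))"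
      unfolding all_leaves_Node[OF False] by simp
    also have "\<dots> \<longleftrightarrow> a \<noteq> d \<and> (\<forall>i<length ts. \<forall>p\<in>set (leaves (ts ! i)).
              \<forall>q. prefix q p \<longrightarrow> dec (subtree_at (ts ! i) q) \<noteq> d)"
    proof -
      \<comment> \<open>A path to a leaf exists, so the condition on \<open>a\<close> can be moved
        out of the quantifiers over paths.\<close>
      have "0 < length ts" "hd (leaves (ts ! 0)) \<in> set (leaves (ts ! 0))"
        using False leaves_nonempty[of "ts ! 0"] by simp_all
      then show ?thesis by blast
    qed
    also have "\<dots> \<longleftrightarrow> a \<noteq> d \<and> (\<forall>i<length ts. \<forall>t\<in>set (subtrees (ts ! i)). dec t \<noteq> d)"
      using Node by simp
    also have "\<dots> \<longleftrightarrow> (\<forall>t\<in>set (subtrees (Node a ts)). dec t \<noteq> d)"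
      unfolding all_subtrees_Node by (simp add: all_set_conv_all_nth)
    finally show ?thesis .
  qed
qed

definition one_colored :: "color rrt \<Rightarrow> bool" where
  "one_colored T \<longleftrightarrow>
     (\<forall>p\<in>set (leaves T). \<exists>!q. prefix q p \<and> dec (subtree_at T q) = Colored)"

text \<open>The prefixes of \<open>i # p\<close> are \<open>[]\<close> and the \<open>i # q\<close>
  with \<open>q\<close> a prefix of \<open>p\<close>. If \<open>[]\<close> qualifies it must be the
  only one; otherwise uniqueness passes to the tail.\<close>

lemma ex1_prefix_Cons:
  "(\<exists>!q. prefix q (i # p) \<and> P q) \<longleftrightarrow>
     (if P [] then \<forall>q. prefix q p \<longrightarrow> \<not> P (i # q) else \<exists>!q. prefix q p \<and> P (i # q))"
proof -
  define Q where "Q q \<longleftrightarrow> prefix q (i # p) \<and> P q" for q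
  have Nil: "Q [] \<longleftrightarrow> P []" by (simp add: Q_def)
  have Cons: "Q (j # q) \<longleftrightarrow> j = i \<and> prefix q p \<and> P (i # q)" for j q
    by (auto simp: Q_def)
  have "(\<exists>!q. Q q) \<longleftrightarrow>
      (if P [] then \<forall>q. prefix q p \<longrightarrow> \<not> P (i # q) else \<exists>!q. prefix q p \<and> P (i # q))"
  proof (cases "P []")
    case True
    then have "Q []" using Nil by simp
    have "(\<exists>!q. Q q) \<longleftrightarrow> (\<forall>q. prefix q p \<longrightarrow> \<not> P (i # q))"
    proof
      assume ex1: "\<exists>!q. Q q"
      have "\<not> Q (i # q)" for q
        using ex1 \<open>Q []\<close> by (metis list.distinct(1))
      then show "\<forall>q. prefix q p \<longrightarrow> \<not> P (i # q)" by (simp add: Cons)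
    next
      assume *: "\<forall>q. prefix q p \<longrightarrow> \<not> P (i # q)"
      show "\<exists>!q. Q q"
      proof (rule ex1I)
        show "Q []" by fact
        show "q = []" if "Q q" for q
          using that * by (cases q) (auto simp add: Cons)
      qed
    qed
    then show ?thesis using True by simp
  next
    case False
    have "(\<exists>!q. Q q) \<longleftrightarrow> (\<exists>!r. prefix r p \<and> P (i # r))"
    proof
      assume "\<exists>!q. Q q"
      then obtain q where q: "Q q" "\<And>q'. Q q' \<Longrightarrow> q' = q" by (elim ex1E) metis
      from q(1) False obtain r where r: "q = i # r" "prefix r p \<and> P (i # r)"
        by (cases q) (simp_all add: Nil Cons)
      show "\<exists>!r. prefix r p \<and> P (i # r)"
      proof (rule ex1I)
        show "prefix r p \<and> P (i # r)" by (fact r(2))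
        show "r' = r" if "prefix r' p \<and> P (i # r')" for r'
          using q(2)[of "i # r'"] that r(1) by (simp add: Cons)
      qed
    next
      assume "\<exists>!r. prefix r p \<and> P (i # r)"
      then obtain r where r: "prefix r p \<and> P (i # r)"
        "\<And>r'. prefix r' p \<and> P (i # r') \<Longrightarrow> r' = r" by (elim ex1E) metis
      show "\<exists>!q. Q q"
      proof (rule ex1I)
        show "Q (i # r)" using r(1) by (simp add: Cons)
        show "q = i # r" if "Q q" for q
          using that False r(2) by (cases q) (simp_all add: Nil Cons)
      qed
    qed
    then show ?thesis using False by simp
  qed
  then show ?thesis by (simp only: Q_def)
qed

lemma one_colored_leaf: "one_colored (Node a []) \<longleftrightarrow> a = Colored"
  by (auto simp: one_colored_def leaves_Node)

lemma one_colored_Colored: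
  "ts \<noteq> [] \<Longrightarrow> one_colored (Node Colored ts) \<longleftrightarrow>
     (\<forall>u\<in>set ts. \<forall>t\<in>set (subtrees u). dec t \<noteq> Colored)"
  unfolding one_colored_def
  by (simp add: all_leaves_Node ex1_prefix_Cons avoids_dec_iff all_set_conv_all_nth[of ts])

lemma one_colored_Uncolored:
  "ts \<noteq> [] \<Longrightarrow> one_colored (Node Uncolored ts) \<longleftrightarrow> (\<forall>t\<in>set ts. one_colored t)"
  unfolding one_colored_def
  by (simp add: all_leaves_Node ex1_prefix_Cons all_set_conv_all_nth[of ts])

text \<open>The conditions of \<open>J_tree\<close> at single vertices, without the path
  condition.\<close>

definition color_ok :: "color rrt \<Rightarrow> bool" where
  "color_ok T \<longleftrightarrow> (\<forall>t\<in>set (subtrees T).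
     (inc t = [] \<longrightarrow> dec t = Uncolored) \<and>
     (inc t \<noteq> [] \<and> dec t = Uncolored \<longrightarrow> 2 \<le> length (inc t)) \<and>
     (dec t = Colored \<longrightarrow> 1 \<le> length (inc t)))"

lemma color_ok_Node:
  "color_ok (Node a ts) \<longleftrightarrow> (a = Colored \<longrightarrow> ts \<noteq> []) \<and>
     (a = Uncolored \<longrightarrow> ts \<noteq> [] \<longrightarrow> 2 \<le> length ts) \<and> (\<forall>t\<in>set ts. color_ok t)"
  unfolding color_ok_def all_subtrees_Node by (cases a) (auto simp: Suc_le_eq)

lemma stable_dec_Uncolored_iff:
  "stable_dec Uncolored T \<longleftrightarrow> color_ok T \<and> (\<forall>t\<in>set (subtrees T). dec t \<noteq> Colored)"
proof (induction T)
  case (Node a ts)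
  then show ?case
    unfolding all_subtrees_Node color_ok_Node stable_dec.simps by (cases a) auto
qed

lemma painted_iff: "painted T \<longleftrightarrow> color_ok T \<and> one_colored T"
proof (induction T rule: painted.induct)
  case (1 ts)
  show ?case
  proof (cases "ts = []")
    case True
    \<comment> \<open>The path of a lone uncolored leaf meets no colored vertex, in agreement with
      the demand of \<open>painted\<close> for two children.\<close>
    then show ?thesis by (simp add: one_colored_leaf)
  next
    case False
    then show ?thesis using 1 by (auto simp: color_ok_Node one_colored_Uncolored)
  qed
next
  case (2 ts)
  show ?case
    by (cases "ts = []") (auto simp: color_ok_Node one_colored_Colored stable_dec_Uncolored_iff)
qed

lemma J_tree_eq: "J_tree n = {T. painted T \<and> length (leaves T) = n}"
  unfolding J_tree_def painted_iff color_ok_def one_colored_def by auto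

section \<open>Assembly of the isomorphisms\<close>

lemma W_le_eq: "W_le = (\<lambda>y x. W_move\<^sup>*\<^sup>* x y)"
  by (intro ext) (simp add: W_le_def)

lemma W_move_iff:
  "W_move (B, S) P \<longleftrightarrow> (\<exists>B'. at_vertex bubble_move B B' \<and> P = (B', S))"
proof -
  have "bubble_move = (\<lambda>t t'. W_move1 t t' \<or> W_move3 t t')"
    by (intro ext) (simp add: bubble_move_def)
  then have "at_vertex bubble_move B B' \<longleftrightarrow> at_vertex W_move1 B B' \<or> at_vertex W_move3 B B'" for B'
    by (subst \<open>bubble_move = _\<close>) (rule at_vertex_disj)
  then show ?thesis
    by (cases P) (auto simp: W_move_def)
qed

lemma W_tree_single_isomorphic:
  "poset_isomorphic (K_tree n) K_le (W_tree [n]) W_le"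
proof -
  have "K_le = (\<lambda>y x. (at_vertex K_move)\<^sup>*\<^sup>* x y)"
    by (intro ext) (simp add: K_le_def)
  moreover have "poset_isomorphic (K_tree n) (\<lambda>y x. (at_vertex K_move)\<^sup>*\<^sup>* x y)
      (W_tree [n]) (\<lambda>y x. W_move\<^sup>*\<^sup>* x y)"
  proof (rule poset_isomorphic_steps)
    show "length (subtrees T) < length (subtrees T')" if "at_vertex K_move T T'" for T T'
      using that block_move_increasing unfolding K_move_eq by (rule at_vertex_increasing)
    show "inj_on (\<lambda>T. (enc None [] T, Node () [])) {T. stable_dec () T}"
      using enc_inj by (auto intro!: inj_onI)
    show "T' \<in> {T. stable_dec () T}" if "T \<in> {T. stable_dec () T}" "at_vertex K_move T T'" for T T'
      using that stable_dec_move by (auto simp: K_move_eq)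
    show "W_move (enc None [] T, Node () []) P \<longleftrightarrow>
        (\<exists>T'. at_vertex K_move T T' \<and> P = (enc None [] T', Node () []))"
      if "T \<in> {T. stable_dec () T}" for T P
      using that bubble_move_enc[of "()" T] by (auto simp: W_move_iff K_move_eq)
    show "K_tree n \<subseteq> {T. stable_dec () T}" by (auto simp: K_tree_iff)
    show "W_tree [n] = (\<lambda>T. (enc None [] T, Node () [])) ` K_tree n" by (rule W_tree_single)
  qed
  ultimately show ?thesis by (simp only: W_le_eq)
qed

lemma W_tree_pair_isomorphic:
  assumes i: "i < 2"
  shows "poset_isomorphic (J_tree n) J_le (W_tree ([0, 0][i := n])) W_le"
proof -
  have "J_le = (\<lambda>y x. (at_vertex J_move)\<^sup>*\<^sup>* x y)"
    by (intro ext) (simp add: J_le_def)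
  moreover have "poset_isomorphic (J_tree n) (\<lambda>y x. (at_vertex J_move)\<^sup>*\<^sup>* x y)
      (W_tree ([0, 0][i := n])) (\<lambda>y x. W_move\<^sup>*\<^sup>* x y)"
  proof (rule poset_isomorphic_steps)
    show "length (subtrees T) < length (subtrees T')" if "at_vertex J_move T T'" for T T'
      using that J_move_increasing by (rule at_vertex_increasing)
    show "inj_on (\<lambda>T. (enc_painted i None T, cherry)) {T. painted T}"
      using enc_painted_inj[OF i] by (auto intro!: inj_onI)
    show "T' \<in> {T. painted T}" if "T \<in> {T. painted T}" "at_vertex J_move T T'" for T T'
      using that painted_move by auto
    show "W_move (enc_painted i None T, cherry) P \<longleftrightarrow>
        (\<exists>T'. at_vertex J_move T T' \<and> P = (enc_painted i None T', cherry))"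
      if "T \<in> {T. painted T}" for T P
      using that bubble_move_enc_painted[OF i, of T] by (auto simp: W_move_iff)
    show "J_tree n \<subseteq> {T. painted T}" by (auto simp: J_tree_eq)
    show "W_tree ([0, 0][i := n]) = (\<lambda>T. (enc_painted i None T, cherry)) ` J_tree n"
      unfolding J_tree_eq by (rule W_tree_pair[OF i])
  qed
  ultimately show ?thesis by (simp only: W_le_eq)
qed

text \<open>The encodings run from \<open>K_tree\<close> and \<open>J_tree\<close> to
  \<open>W_tree\<close>, so the first two isomorphisms are inverted; the indices \<open>0\<close>
  and \<open>1\<close> give the two types with \<open>r = 2\<close>.\<close>

theorem lemma3p9:
  fixes n :: nat
  assumes "n \<ge> 1"
  shows "poset_isomorphic (W_tree [n]) W_le (K_tree n) K_le
       \<and> poset_isomorphic (W_tree [n, 0]) W_le (J_tree n) J_le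
       \<and> poset_isomorphic (J_tree n) J_le (W_tree [0, n]) W_le"
  using poset_isomorphic_sym[OF W_tree_single_isomorphic[of n]]
    poset_isomorphic_sym[OF W_tree_pair_isomorphic[of 0 n]] W_tree_pair_isomorphic[of 1 n]
  by simp

end
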